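(* Let $n\ge k\ge 1$ be integers. Then \[ \overline{s}_{(1^k)}(x_1,\dots,x_n)=\sum_{|\mu|=k}|P(\mu,n)|\,s_\mu(x_1,\dots,x_n), \] where the sum is over partitions $\mu$ of $k$.
   Context: For a partition $\lambda$ with at most $n$ parts, $\overline{s}_\lambda(x_1,\dots,x_n):=s_\lambda(p-x_1,p-x_2,\dots,p-x_n)$ where $p=x_1+\dots+x_n$ and $s_\lambda$ is the Schur polynomial in $n$ variables. $(1^k)$ denotes the partition with $k$ parts equal to $1$. For a partition $\mu$, ${\rm SYT}(\mu,n)$ is the set of fillings of the Young diagram of $\mu$ with distinct numbers from $[n]=\{1,\dots,n\}$ that are strictly increasing along rows and down columns (entries larger than the number of boxes are allowed). $P(\mu,n)$ is the set of $T\in{\rm SYT}(\mu,n)$ such that the smallest positive integer not appearing in the first (leftmost) column of $T$ is odd. *)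

theory Defs
  imports Complex_Main "HOL-Library.FuncSet"
begin

definition is_partition :: "nat list \<Rightarrow> bool" where
  "is_partition \<mu> \<longleftrightarrow> sorted_wrt (\<ge>) \<mu> \<and> (\<forall>m\<in>set \<mu>. m \<ge> 1)"

definition partitions_of :: "nat \<Rightarrow> nat list set" where
  "partitions_of k = {\<mu>. is_partition \<mu> \<and> sum_list \<mu> = k}"

text \<open>Boxes are pairs (row, column) in English notation, both counted from 0; the leftmost column
  is column 0.\<close>

definition diagram :: "nat list \<Rightarrow> (nat \<times> nat) set" where
  "diagram \<mu> = {(i, j). i < length \<mu> \<and> j < \<mu> ! i}"

text \<open>A filling is an extensional function (undefined outside the diagram), so
  that different functions are different fillings and the sets below can be counted.\<close>

definition SSYT :: "nat list \<Rightarrow> nat \<Rightarrow> (nat \<times> nat \<Rightarrow> nat) set" where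
  "SSYT \<mu> n = {T \<in> diagram \<mu> \<rightarrow>\<^sub>E {1..n}.
     (\<forall>i j j'. j < j' \<and> (i, j) \<in> diagram \<mu> \<and> (i, j') \<in> diagram \<mu> \<longrightarrow> T (i, j) \<le> T (i, j')) \<and>
     (\<forall>i i' j. i < i' \<and> (i, j) \<in> diagram \<mu> \<and> (i', j) \<in> diagram \<mu> \<longrightarrow> T (i, j) < T (i', j))}"

definition SYT :: "nat list \<Rightarrow> nat \<Rightarrow> (nat \<times> nat \<Rightarrow> nat) set" where
  "SYT \<mu> n = {T \<in> diagram \<mu> \<rightarrow>\<^sub>E {1..n}. inj_on T (diagram \<mu>) \<and>
     (\<forall>i j j'. j < j' \<and> (i, j) \<in> diagram \<mu> \<and> (i, j') \<in> diagram \<mu> \<longrightarrow> T (i, j) < T (i, j')) \<and>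
     (\<forall>i i' j. i < i' \<and> (i, j) \<in> diagram \<mu> \<and> (i', j) \<in> diagram \<mu> \<longrightarrow> T (i, j) < T (i', j))}"

definition first_column :: "nat list \<Rightarrow> (nat \<times> nat \<Rightarrow> nat) \<Rightarrow> nat set" where
  "first_column \<mu> T = {T (i, 0) |i. (i, 0) \<in> diagram \<mu>}"

definition P :: "nat list \<Rightarrow> nat \<Rightarrow> (nat \<times> nat \<Rightarrow> nat) set" where
  "P \<mu> n = {T \<in> SYT \<mu> n. odd (LEAST m. m \<ge> 1 \<and> m \<notin> first_column \<mu> T)}"

text \<open>The Schur polynomial in n variables, as the generating function of semistandard tableaux,
  evaluated at elements x 1, ..., x n of an arbitrary commutative ring. An identity between such
  expressions for all x over all commutative rings is the same as the identity of polynomials with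
  integer coefficients: take the ring to be the integer polynomials (the type
  \<open>(nat \<Rightarrow>\<^sub>0 nat) \<Rightarrow>\<^sub>0 int\<close> of HOL-Library.Poly_Mapping) and x i the i-th variable.\<close>

definition schur :: "nat list \<Rightarrow> nat \<Rightarrow> (nat \<Rightarrow> 'a) \<Rightarrow> 'a::comm_ring_1" where
  "schur \<mu> n x = (\<Sum>T\<in>SSYT \<mu> n. \<Prod>b\<in>diagram \<mu>. x (T b))"

definition schur_bar :: "nat list \<Rightarrow> nat \<Rightarrow> (nat \<Rightarrow> 'a) \<Rightarrow> 'a::comm_ring_1" where
  "schur_bar \<mu> n x = schur \<mu> n (\<lambda>i. (\<Sum>j=1..n. x j) - x i)"

text \<open>None of the sums and cardinalities in use is over an infinite set.\<close>

lemma finite_diagram: "finite (diagram \<mu>)"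
proof -
  have "diagram \<mu> = Sigma {..<length \<mu>} (\<lambda>i. {..<\<mu> ! i})"
    by (auto simp: diagram_def)
  then show ?thesis by simp
qed

lemma finite_SSYT: "finite (SSYT \<mu> n)"
  unfolding SSYT_def by (simp add: finite_diagram finite_PiE)

lemma finite_SYT: "finite (SYT \<mu> n)"
  unfolding SYT_def by (simp add: finite_diagram finite_PiE)

lemma finite_P: "finite (P \<mu> n)"
  unfolding P_def by (simp add: finite_SYT)

lemma finite_partitions_of: "finite (partitions_of k)"
proof (rule finite_subset)
  have len: "length \<mu> \<le> sum_list \<mu>" if "\<forall>m\<in>set \<mu>. m \<ge> 1" for \<mu> :: "nat list"
    using that by (induction \<mu>) auto
  show "partitions_of k \<subseteq> {\<mu>. set \<mu> \<subseteq> {..k} \<and> length \<mu> \<le> k}"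
    using len by (auto simp: partitions_of_def is_partition_def dest: member_le_sum_list)
  show "finite {\<mu>. set \<mu> \<subseteq> {..k} \<and> length \<mu> \<le> k}"
    by (rule finite_lists_length_le) simp
qed

end

theory Submission
  imports Defs
begin

text \<open>Write \<open>p = x\<^sub>1 + \<dots> + x\<^sub>n\<close>. Expanding the product over subsets gives
  \<open>e\<^sub>k(p - x\<^sub>1, \<dots>, p - x\<^sub>n) = \<Sum>\<^sub>j (-1)\<^sup>j (n-j choose k-j) p\<^bsup>k-j\<^esup> e\<^sub>j\<close>.
  By the Pieri rule for multiplication by \<open>p\<close>, the coefficient of \<open>s\<^sub>\<mu>\<close> in
  \<open>(n-j choose k-j) p\<^bsup>k-j\<^esup> e\<^sub>j\<close> is the number of \<open>T \<in> SYT(\<mu>, n)\<close> whose first column contains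
  \<open>1, \<dots>, j\<close>: the remaining \<open>k-j\<close> entries are chosen from \<open>j+1, \<dots>, n\<close> and placed one box
  at a time. If \<open>m\<close> is the smallest number missing in the first column of \<open>T\<close>, then \<open>T\<close> is counted
  with total weight \<open>\<Sum>\<^bsub>j<m\<^esub> (-1)\<^sup>j\<close>, which is 1 for odd \<open>m\<close> and 0 for even \<open>m\<close>.

  The Pieri rule itself is proved by induction on the number of variables: splitting off the last
  variable turns it into a count of the ways in which a box can be added to \<open>\<kappa>\<close>, or removed
  from \<open>\<nu>\<close>, such that the two shapes interlace.\<close>

section \<open>Interlacing shapes and the Pieri rule\<close>

text \<open>Equivalently, the skew shape \<kappa>/\<nu> is a horizontal strip: it has no two boxes
  in one column. Shapes are functions on all row indices, so that adding or removing a box is a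
  function update, even where the result is no partition.\<close>

definition interlace :: "(nat \<Rightarrow> nat) \<Rightarrow> (nat \<Rightarrow> nat) \<Rightarrow> bool" where
  "interlace \<nu> \<kappa> \<longleftrightarrow> (\<forall>i. \<kappa> (Suc i) \<le> \<nu> i \<and> \<nu> i \<le> \<kappa> i)"

lemma interlaceD: "interlace \<nu> \<kappa> \<Longrightarrow> \<kappa> (Suc i) \<le> \<nu> i" "interlace \<nu> \<kappa> \<Longrightarrow> \<nu> i \<le> \<kappa> i"
  by (auto simp: interlace_def)

lemma interlace_antimono:
  assumes "interlace \<nu> \<kappa>"
  shows "antimono \<nu>" "antimono \<kappa>"
  using assms by (auto simp: interlace_def antimono_iff_le_Suc intro: order_trans)

text \<open>Supplies the finiteness of the index sets of shapes; a sum over an infinite set would be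
  0 by convention.\<close>

lemma finite_bounded_supported:
  "finite {\<nu> :: nat \<Rightarrow> nat. (\<forall>i. \<nu> i \<le> M) \<and> (\<forall>i\<ge>N. \<nu> i = 0)}"
proof (rule finite_subset)
  show "{\<nu>. (\<forall>i. \<nu> i \<le> M) \<and> (\<forall>i\<ge>N. \<nu> i = 0)}
      \<subseteq> {\<nu>. \<forall>i. (i \<in> {..<N} \<longrightarrow> \<nu> i \<in> {..M}) \<and> (i \<notin> {..<N} \<longrightarrow> \<nu> i = 0)}" by auto
  show "finite {\<nu> :: nat \<Rightarrow> nat. \<forall>i. (i \<in> {..<N} \<longrightarrow> \<nu> i \<in> {..M}) \<and> (i \<notin> {..<N} \<longrightarrow> \<nu> i = 0)}"
    by (rule finite_set_of_finite_funs) auto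
qed

text \<open>If \<open>\<nu>\<close> and \<open>\<kappa>\<close> interlace, removing a box from row \<open>i\<close> of \<open>\<nu>\<close> corresponds to adding one to row
  \<open>i + 1\<close> of \<open>\<kappa>\<close>, and row 0 of \<open>\<kappa>\<close> accounts for the extra 1; otherwise the rows are the same.\<close>

lemma interlace_count:
  assumes l: "antimono \<kappa>" and v: "antimono \<nu>" and N: "\<nu> N = 0"
  shows "card {i. i < Suc N \<and> \<nu> i > 0 \<and> interlace (\<nu>(i := \<nu> i - 1)) \<kappa>} + of_bool (interlace \<nu> \<kappa>)
    = card {i. i < Suc N \<and> interlace \<nu> (\<kappa>(i := Suc (\<kappa> i)))}"
    (is "card ?A + _ = card ?B")
proof (cases "interlace \<nu> \<kappa>")
  case True
  have "?B = insert 0 (Suc ` ?A)"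
  proof (intro set_eqI iffI)
    fix i assume i: "i \<in> ?B"
    show "i \<in> insert 0 (Suc ` ?A)"
    proof (cases i)
      case (Suc j)
      with i have "interlace \<nu> (\<kappa>(Suc j := Suc (\<kappa> (Suc j))))" by simp
      from interlaceD(1)[OF this, of j] have "\<kappa> (Suc j) < \<nu> j" by simp
      with True have "interlace (\<nu>(j := \<nu> j - 1)) \<kappa>"
        by (auto simp: interlace_def le_diff_conv intro: le_SucI)
      then show ?thesis using Suc i \<open>\<kappa> (Suc j) < \<nu> j\<close> by auto
    qed simp
  next
    fix i assume i: "i \<in> insert 0 (Suc ` ?A)"
    show "i \<in> ?B"
    proof (cases i)
      case 0
      then show ?thesis using True by (auto simp: interlace_def intro: le_SucI)
    next
      case (Suc j)
      with i have j: "j < Suc N" "\<nu> j > 0" "interlace (\<nu>(j := \<nu> j - 1)) \<kappa>" by auto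
      \<comment> \<open>Since \<open>\<nu> N = 0\<close>, no box can be removed from row
        \<open>N\<close>; hence the shifted row \<open>Suc j\<close> stays below
        \<open>Suc N\<close>.\<close>
      have "j \<noteq> N" using j N by auto
      moreover from interlaceD(1)[OF j(3), of j] j have "\<kappa> (Suc j) < \<nu> j" by auto
      ultimately show ?thesis using True Suc j by (auto simp: interlace_def intro: le_SucI)
    qed
  qed
  then show ?thesis using True by (simp add: card_image)
next
  case False
  have "i \<in> ?A \<longleftrightarrow> i \<in> ?B" for i
  proof
    assume i: "i \<in> ?A"
    then have *: "\<kappa> (Suc j) \<le> (\<nu>(i := \<nu> i - 1)) j \<and> (\<nu>(i := \<nu> i - 1)) j \<le> \<kappa> j" for j
      by (auto simp: interlace_def)
    \<comment> \<open>The condition on \<open>i\<close> forces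
      \<open>\<nu> i \<le> Suc (\<kappa> i)\<close>. If the inequality were strict, putting the box
      back would not violate anything, and \<nu> and \<kappa> would interlace after all.\<close>
    have "\<nu> i = Suc (\<kappa> i)"
    proof (rule ccontr)
      assume n: "\<nu> i \<noteq> Suc (\<kappa> i)"
      have "interlace \<nu> \<kappa>" unfolding interlace_def
      proof
        fix j show "\<kappa> (Suc j) \<le> \<nu> j \<and> \<nu> j \<le> \<kappa> j"
          using *[of j] n by (cases "j = i") auto
      qed
      with False show False ..
    qed
    then have "interlace \<nu> (\<kappa>(i := Suc (\<kappa> i)))" unfolding interlace_def
    proof (intro allI)
      fix j show "(\<kappa>(i := Suc (\<kappa> i))) (Suc j) \<le> \<nu> j \<and> \<nu> j \<le> (\<kappa>(i := Suc (\<kappa> i))) j"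
        using *[of j] antimonoD[OF v, of j "Suc j"] \<open>\<nu> i = Suc (\<kappa> i)\<close> by (auto split: if_splits)
    qed
    with i show "i \<in> ?B" by simp
  next
    assume i: "i \<in> ?B"
    then have *: "(\<kappa>(i := Suc (\<kappa> i))) (Suc j) \<le> \<nu> j \<and> \<nu> j \<le> (\<kappa>(i := Suc (\<kappa> i))) j" for j
      by (auto simp: interlace_def)
    \<comment> \<open>The same dichotomy from the other side: a row \<open>i\<close> of \<kappa>
      that did not need the additional box would make \<nu> and \<kappa> interlace.\<close>
    have vi: "\<nu> i = Suc (\<kappa> i)"
    proof (rule ccontr)
      assume n: "\<nu> i \<noteq> Suc (\<kappa> i)"
      have "interlace \<nu> \<kappa>" unfolding interlace_def
      proof
        fix j show "\<kappa> (Suc j) \<le> \<nu> j \<and> \<nu> j \<le> \<kappa> j"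
          using *[of j] n by (cases "j = i"; cases "Suc j = i") auto
      qed
      with False show False ..
    qed
    have "interlace (\<nu>(i := \<nu> i - 1)) \<kappa>" unfolding interlace_def
    proof
      fix j show "\<kappa> (Suc j) \<le> (\<nu>(i := \<nu> i - 1)) j \<and> (\<nu>(i := \<nu> i - 1)) j \<le> \<kappa> j"
        using *[of j] antimonoD[OF l, of j "Suc j"] vi by (auto split: if_splits)
    qed
    with i vi show "i \<in> ?A" by simp
  qed
  then have "?A = ?B" by blast
  then show ?thesis using False by simp
qed

text \<open>The number \<open>N\<close> only serves to measure shapes: it bounds the number of their rows.\<close>

primrec branch_schur :: "nat \<Rightarrow> (nat \<Rightarrow> 'a) \<Rightarrow> nat \<Rightarrow> (nat \<Rightarrow> nat) \<Rightarrow> 'a::comm_ring_1" where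
  "branch_schur N x 0 \<kappa> = of_bool (\<forall>i. \<kappa> i = 0)"
| "branch_schur N x (Suc n) \<kappa>
    = (\<Sum>\<nu> | interlace \<nu> \<kappa>. x (Suc n) ^ (sum \<kappa> {..<N} - sum \<nu> {..<N}) * branch_schur N x n \<nu>)"

text \<open>Each variable can remove at most one row: \<open>\<kappa> (Suc n) \<le> \<nu> n\<close>
  hands the excess row down to the case of no variables, where only the empty shape
  survives.\<close>

lemma branch_schur_eq_0:
  assumes "\<kappa> n > 0"
  shows "branch_schur N x n \<kappa> = 0"
  using assms
proof (induction n arbitrary: \<kappa>)
  case (Suc n)
  then show ?case by (auto intro!: sum.neutral dest: interlaceD(1)[of _ _ n])
qed auto

text \<open>Allows the Pieri rule to add a box to every row: where the result is not a partition,
  the term vanishes.\<close>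

lemma branch_schur_not_antimono:
  assumes "\<not> antimono \<kappa>"
  shows "branch_schur N x n \<kappa> = 0"
proof (cases n)
  case 0
  moreover have "\<not> (\<forall>i. \<kappa> i = 0)"
  proof
    assume "\<forall>i. \<kappa> i = 0"
    then have "antimono \<kappa>" by (simp add: antimono_def)
    with assms show False ..
  qed
  ultimately show ?thesis by simp
next
  case (Suc m)
  then show ?thesis using assms interlace_antimono(2) by (auto intro!: sum.neutral)
qed

lemma sum_add_box:
  fixes \<kappa> :: "nat \<Rightarrow> nat"
  assumes "i < N"
  shows "sum (\<kappa>(i := Suc (\<kappa> i))) {..<N} = Suc (sum \<kappa> {..<N})"
proof -
  have "sum (\<kappa>(i := Suc (\<kappa> i))) {..<N} = Suc (\<kappa> i) + sum \<kappa> ({..<N} - {i})"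
    using assms by (subst sum.remove[of _ i]) (auto intro!: sum.cong)
  also have "\<dots> = Suc (sum \<kappa> {..<N})"
    using assms by (subst (2) sum.remove[of _ i]) auto
  finally show ?thesis .
qed

text \<open>After the last variable is split off, everything becomes a combination of the same terms
  \<open>f \<nu>\<close> over one finite set \<open>U\<close>, and \<open>interlace_count\<close>
  shows that the coefficients agree.\<close>

theorem branch_schur_pieri:
  fixes x :: "nat \<Rightarrow> 'a::comm_ring_1"
  assumes "antimono \<kappa>" and "\<forall>i\<ge>N. \<kappa> i = 0" and "n \<le> N"
  shows "(\<Sum>i=1..n. x i) * branch_schur N x n \<kappa>
       = (\<Sum>i<N. branch_schur N x n (\<kappa>(i := Suc (\<kappa> i))))"
  using assms
proof (induction n arbitrary: \<kappa>)
  case 0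
  have "\<not> (\<forall>j. (\<kappa>(i := Suc (\<kappa> i))) j = 0)" for i by (auto intro: exI[of _ i])
  then show ?case by (simp only: branch_schur.simps of_bool_eq) simp
next
  case (Suc n)
  note l = Suc.prems(1) and supp = Suc.prems(2)
  obtain M where M: "N = Suc M" "n \<le> M" using Suc.prems(3) by (cases N) auto
  \<comment> \<open>A common index set: it contains all \<nu> that interlace with \<kappa>, or with
    \<kappa> plus one box in a row below \<open>N\<close>.\<close>
  define U where "U = {\<nu> :: nat \<Rightarrow> nat. (\<forall>i. \<nu> i \<le> Suc (\<kappa> 0)) \<and> (\<forall>i\<ge>N. \<nu> i = 0)}"
  have finU: "finite U" unfolding U_def by (rule finite_bounded_supported)
  \<comment> \<open>The exponent counts the boxes of \<kappa> plus one that lie outside \<nu>; it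
    does not depend on the row that receives the new box.\<close>
  define f where "f \<nu> = x (Suc n) ^ (Suc (sum \<kappa> {..<N}) - sum \<nu> {..<N}) * branch_schur N x n \<nu>" for \<nu>
  have il: "\<mu> \<in> U" "antimono \<mu>" "\<forall>i\<ge>N. \<mu> i = 0" "sum \<mu> {..<N} \<le> sum \<kappa> {..<N}"
    if "interlace \<mu> \<kappa>" for \<mu>
  proof -
    have le: "\<mu> i \<le> \<kappa> i" for i using that by (auto dest: interlaceD)
    moreover have "\<kappa> i \<le> \<kappa> 0" for i using l by (auto dest: antimonoD)
    ultimately have "\<mu> i \<le> Suc (\<kappa> 0)" for i using le_SucI order_trans by blast
    moreover show *: "\<forall>i\<ge>N. \<mu> i = 0" using le supp by (metis le_zero_eq)
    ultimately show "\<mu> \<in> U" unfolding U_def by blast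
    show "antimono \<mu>" using that interlace_antimono by blast
    show "sum \<mu> {..<N} \<le> sum \<kappa> {..<N}" by (rule sum_mono) (rule le)
  qed
  have U2: "\<nu> \<in> U" if "interlace \<nu> (\<kappa>(i := Suc (\<kappa> i)))" "i < N" for \<nu> i
  proof -
    have le: "\<nu> j \<le> (\<kappa>(i := Suc (\<kappa> i))) j" for j using that by (blast dest: interlaceD)
    have "\<kappa> j \<le> \<kappa> 0" for j using l by (auto dest: antimonoD)
    then have "(\<kappa>(i := Suc (\<kappa> i))) j \<le> Suc (\<kappa> 0)" for j by (auto intro: le_SucI)
    then have "\<nu> j \<le> Suc (\<kappa> 0)" for j using le order_trans by blast
    moreover have "\<nu> j = 0" if "j \<ge> N" for j using le[of j] \<open>i < N\<close> that supp by auto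
    ultimately show ?thesis by (auto simp: U_def)
  qed
  have fin: "finite {\<mu>. interlace \<mu> \<kappa>}" by (rule finite_subset[OF _ finU]) (use il in auto)
  \<comment> \<open>The induction hypothesis adds a box to the inner shape \<mu>. Writing \<nu> for
    the enlarged shape leaves the exponent unchanged and turns the condition on \<mu> into one on
    \<nu> with a box removed.\<close>
  have 1: "(\<Sum>i=1..n. x i) * branch_schur N x (Suc n) \<kappa>
      = (\<Sum>i<N. \<Sum>\<nu>\<in>U. of_bool (\<nu> i > 0 \<and> interlace (\<nu>(i := \<nu> i - 1)) \<kappa>) * f \<nu>)"
  proof -
    have "(\<Sum>i=1..n. x i) * branch_schur N x (Suc n) \<kappa>
      = (\<Sum>\<mu> | interlace \<mu> \<kappa>. x (Suc n) ^ (sum \<kappa> {..<N} - sum \<mu> {..<N})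
            * ((\<Sum>i=1..n. x i) * branch_schur N x n \<mu>))"
      by (simp add: sum_distrib_left mult.left_commute)
    also have "\<dots> = (\<Sum>\<mu> | interlace \<mu> \<kappa>. \<Sum>i<N. f (\<mu>(i := Suc (\<mu> i))))"
    proof (rule sum.cong[OF refl])
      fix \<mu> assume "\<mu> \<in> {\<mu>. interlace \<mu> \<kappa>}"
      then have "(\<Sum>i=1..n. x i) * branch_schur N x n \<mu> = (\<Sum>i<N. branch_schur N x n (\<mu>(i := Suc (\<mu> i))))"
        using il(2,3)[of \<mu>] Suc.prems(3) by (intro Suc.IH) auto
      then show "x (Suc n) ^ (sum \<kappa> {..<N} - sum \<mu> {..<N}) * ((\<Sum>i=1..n. x i) * branch_schur N x n \<mu>)
          = (\<Sum>i<N. f (\<mu>(i := Suc (\<mu> i))))"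
        by (simp add: f_def sum_add_box sum_distrib_left del: fun_upd_apply)
    qed
    also have "\<dots> = (\<Sum>i<N. \<Sum>\<mu> | interlace \<mu> \<kappa>. f (\<mu>(i := Suc (\<mu> i))))"
      by (rule sum.swap)
    also have "\<dots> = (\<Sum>i<N. \<Sum>\<nu> | \<nu> \<in> U \<and> \<nu> i > 0 \<and> interlace (\<nu>(i := \<nu> i - 1)) \<kappa>. f \<nu>)"
    proof (rule sum.cong[OF refl])
      fix i assume i: "i \<in> {..<N}"
      show "(\<Sum>\<mu> | interlace \<mu> \<kappa>. f (\<mu>(i := Suc (\<mu> i))))
          = (\<Sum>\<nu> | \<nu> \<in> U \<and> \<nu> i > 0 \<and> interlace (\<nu>(i := \<nu> i - 1)) \<kappa>. f \<nu>)"
      proof (rule sum.reindex_bij_witness[where i = "\<lambda>\<nu>. \<nu>(i := \<nu> i - 1)" and j = "\<lambda>\<mu>. \<mu>(i := Suc (\<mu> i))"])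
        fix \<mu> assume "\<mu> \<in> {\<mu>. interlace \<mu> \<kappa>}"
        then have m: "interlace \<mu> \<kappa>" by simp
        have "\<kappa> j \<le> \<kappa> 0" for j using l by (auto dest: antimonoD)
        then have "\<mu> j \<le> \<kappa> 0" for j using interlaceD(2)[OF m] order_trans by blast
        then have "\<mu>(i := Suc (\<mu> i)) \<in> U" using il(3)[OF m] i by (auto simp: U_def intro: le_SucI)
        then show "\<mu>(i := Suc (\<mu> i)) \<in> {\<nu> \<in> U. 0 < \<nu> i \<and> interlace (\<nu>(i := \<nu> i - 1)) \<kappa>}"
          using m by simp
      qed auto
    qed
    also have "\<dots> = (\<Sum>i<N. \<Sum>\<nu>\<in>U. of_bool (\<nu> i > 0 \<and> interlace (\<nu>(i := \<nu> i - 1)) \<kappa>) * f \<nu>)"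
      using finU by (intro sum.cong[OF refl]) (auto intro!: sum.mono_neutral_cong_left)
    finally show ?thesis .
  qed
  \<comment> \<open>The extra factor raises the exponent by one. The truncated subtraction is
    harmless because \<nu> has no more boxes than \<kappa>.\<close>
  have 2: "x (Suc n) * branch_schur N x (Suc n) \<kappa> = (\<Sum>\<nu>\<in>U. of_bool (interlace \<nu> \<kappa>) * f \<nu>)"
  proof -
    have "x (Suc n) * branch_schur N x (Suc n) \<kappa> = (\<Sum>\<nu> | interlace \<nu> \<kappa>. f \<nu>)"
      using il by (auto simp: sum_distrib_left f_def Suc_diff_le mult.assoc intro!: sum.cong)
    also have "\<dots> = (\<Sum>\<nu>\<in>U. of_bool (interlace \<nu> \<kappa>) * f \<nu>)"
      using finU il by (auto intro!: sum.mono_neutral_cong_left)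
    finally show ?thesis .
  qed
  have 3: "branch_schur N x (Suc n) (\<kappa>(i := Suc (\<kappa> i)))
      = (\<Sum>\<nu>\<in>U. of_bool (interlace \<nu> (\<kappa>(i := Suc (\<kappa> i)))) * f \<nu>)" if "i < N" for i
    using finU U2 that
    by (auto simp: sum_add_box f_def simp del: fun_upd_apply intro!: sum.mono_neutral_cong_left)
  have cnt: "(\<Sum>i<N. of_bool (\<nu> i > 0 \<and> interlace (\<nu>(i := \<nu> i - 1)) \<kappa>) * f \<nu>)
        + of_bool (interlace \<nu> \<kappa>) * f \<nu>
      = (\<Sum>i<N. of_bool (interlace \<nu> (\<kappa>(i := Suc (\<kappa> i)))) * f \<nu>)" for \<nu>
  \<comment> \<open>Only in this case does \<open>interlace_count\<close> apply, with
    \<open>M\<close> as its bound. Otherwise \<nu> is no partition or has more than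
    \<open>M\<close>, hence more than \<open>n\<close>, rows, and \<open>f \<nu>\<close> is
    0.\<close>
  proof (cases "antimono \<nu> \<and> \<nu> M = 0")
    case True
    have cs: "(\<Sum>i<N. of_bool (Q i)) = (of_nat (card {i. i < Suc M \<and> Q i}) :: 'a)" for Q
    proof -
      have "{..<N} \<inter> Collect Q = {i. i < Suc M \<and> Q i}" using M by auto
      then show ?thesis by simp
    qed
    show ?thesis
      unfolding sum_distrib_right[symmetric] cs distrib_right[symmetric]
      using arg_cong[OF interlace_count[OF l conjunct1[OF True] conjunct2[OF True]], of "of_nat :: nat \<Rightarrow> 'a"]
      by (simp only: of_nat_add of_nat_of_bool)
  next
    case False
    have "f \<nu> = 0"
    proof (cases "antimono \<nu>")
      case True
      then have "\<nu> n \<ge> \<nu> M" using M by (auto dest: antimonoD)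
      then have "\<nu> n > 0" using False True by simp
      then show ?thesis by (simp add: f_def branch_schur_eq_0)
    qed (simp add: f_def branch_schur_not_antimono)
    then show ?thesis by simp
  qed
  have "(\<Sum>i=1..Suc n. x i) * branch_schur N x (Suc n) \<kappa>
      = (\<Sum>i=1..n. x i) * branch_schur N x (Suc n) \<kappa> + x (Suc n) * branch_schur N x (Suc n) \<kappa>"
    by (simp add: distrib_right)
  also have "\<dots> = (\<Sum>\<nu>\<in>U. (\<Sum>i<N. of_bool (\<nu> i > 0 \<and> interlace (\<nu>(i := \<nu> i - 1)) \<kappa>) * f \<nu>)
        + of_bool (interlace \<nu> \<kappa>) * f \<nu>)"
    unfolding 1 2 by (subst sum.swap) (simp add: sum.distrib)
  also have "\<dots> = (\<Sum>i<N. \<Sum>\<nu>\<in>U. of_bool (interlace \<nu> (\<kappa>(i := Suc (\<kappa> i)))) * f \<nu>)"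
    unfolding cnt by (rule sum.swap)
  also have "\<dots> = (\<Sum>i<N. branch_schur N x (Suc n) (\<kappa>(i := Suc (\<kappa> i))))"
    by (intro sum.cong refl 3[symmetric]) simp
  finally show ?case .
qed

section \<open>The branching rule for semistandard tableaux\<close>

definition shape :: "(nat \<Rightarrow> nat) \<Rightarrow> (nat \<times> nat) set" where
  "shape \<kappa> = {(i, j). j < \<kappa> i}"

lemma mem_shape [simp]: "(i, j) \<in> shape \<kappa> \<longleftrightarrow> j < \<kappa> i"
  by (simp add: shape_def)

lemma
  assumes "\<forall>i\<ge>N. \<kappa> i = 0"
  shows finite_shape: "finite (shape \<kappa>)"
    and card_shape: "card (shape \<kappa>) = sum \<kappa> {..<N}"
proof -
  have "i < N" if "j < \<kappa> i" for i j using assms that by (metis not_less not_less0)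
  then have "shape \<kappa> = Sigma {..<N} (\<lambda>i. {..<\<kappa> i})" by (auto simp: shape_def)
  then show "finite (shape \<kappa>)" "card (shape \<kappa>) = sum \<kappa> {..<N}" by simp_all
qed

definition ssyt :: "(nat \<Rightarrow> nat) \<Rightarrow> nat \<Rightarrow> (nat \<times> nat \<Rightarrow> nat) set" where
  "ssyt \<kappa> n = {T \<in> shape \<kappa> \<rightarrow>\<^sub>E {1..n}.
     (\<forall>i j j'. j < j' \<and> j' < \<kappa> i \<longrightarrow> T (i, j) \<le> T (i, j')) \<and>
     (\<forall>i i' j. i < i' \<and> j < \<kappa> i \<and> j < \<kappa> i' \<longrightarrow> T (i, j) < T (i', j))}"

lemma ssytD:
  assumes "T \<in> ssyt \<kappa> n"
  shows "T \<in> shape \<kappa> \<rightarrow>\<^sub>E {1..n}"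
    and "j < \<kappa> i \<Longrightarrow> 1 \<le> T (i, j)" and "j < \<kappa> i \<Longrightarrow> T (i, j) \<le> n"
    and "j < j' \<Longrightarrow> j' < \<kappa> i \<Longrightarrow> T (i, j) \<le> T (i, j')"
    and "i < i' \<Longrightarrow> j < \<kappa> i \<Longrightarrow> j < \<kappa> i' \<Longrightarrow> T (i, j) < T (i', j)"
proof -
  show 1: "T \<in> shape \<kappa> \<rightarrow>\<^sub>E {1..n}" using assms by (auto simp: ssyt_def)
  show "1 \<le> T (i, j)" "T (i, j) \<le> n" if "j < \<kappa> i"
    using PiE_mem[OF 1, of "(i, j)"] that by auto
  show "j < j' \<Longrightarrow> j' < \<kappa> i \<Longrightarrow> T (i, j) \<le> T (i, j')" using assms by (auto simp: ssyt_def)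
  show "i < i' \<Longrightarrow> j < \<kappa> i \<Longrightarrow> j < \<kappa> i' \<Longrightarrow> T (i, j) < T (i', j)"
    using assms by (auto simp: ssyt_def)
qed

lemma finite_ssyt: "finite (shape \<kappa>) \<Longrightarrow> finite (ssyt \<kappa> n)"
  unfolding ssyt_def by (simp add: finite_PiE)

text \<open>A downward closed set of numbers below \<open>m\<close> is an initial segment, whose
  length is its cardinality. This turns the number of small entries in a row into a row
  length.\<close>

lemma less_card_initial_segment:
  fixes m :: nat
  assumes "\<And>j k. j < k \<Longrightarrow> k < m \<Longrightarrow> Q k \<Longrightarrow> Q j"
  shows "j < card {j. j < m \<and> Q j} \<longleftrightarrow> j < m \<and> Q j"
proof -
  let ?A = "{j. j < m \<and> Q j}"
  define c where "c = (LEAST c. c \<notin> ?A)"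
  have "c \<notin> ?A" unfolding c_def by (rule LeastI[of _ m]) simp
  moreover have "j \<in> ?A" if "j < c" for j using not_less_Least that unfolding c_def by blast
  moreover have "c \<in> ?A" if "j \<in> ?A" "c \<le> j" for j
    using that assms[of c j] by (cases "c = j") auto
  ultimately have "j \<in> ?A \<longleftrightarrow> j < c" for j by (metis not_less)
  then have "?A = {..<c}" by blast
  then have "card ?A = c" by simp
  then show ?thesis using \<open>?A = {..<c}\<close> by blast
qed

definition small_shape :: "(nat \<Rightarrow> nat) \<Rightarrow> nat \<Rightarrow> (nat \<times> nat \<Rightarrow> nat) \<Rightarrow> nat \<Rightarrow> nat" where
  "small_shape \<kappa> n T i = card {j. j < \<kappa> i \<and> T (i, j) \<le> n}"

lemma less_small_shape:
  assumes "T \<in> ssyt \<kappa> r"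
  shows "j < small_shape \<kappa> n T i \<longleftrightarrow> j < \<kappa> i \<and> T (i, j) \<le> n"
  unfolding small_shape_def
proof (rule less_card_initial_segment)
  fix j k assume "j < k" "k < \<kappa> i" "T (i, k) \<le> n"
  then show "T (i, j) \<le> n" using ssytD(4)[OF assms, of j k i] by simp
qed

text \<open>Deleting all entries \<open>Suc n\<close> removes a horizontal strip: an entry with a
  box below it is smaller than an entry that is at most \<open>Suc n\<close>, so it
  survives.\<close>

lemma ssyt_restrict:
  assumes \<kappa>: "antimono \<kappa>" and T: "T \<in> ssyt \<kappa> (Suc n)"
  shows "interlace (small_shape \<kappa> n T) \<kappa>"
    and "restrict T (shape (small_shape \<kappa> n T)) \<in> ssyt (small_shape \<kappa> n T) n"
proof -
  let ?\<nu> = "small_shape \<kappa> n T"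
  note ls = less_small_shape[OF T]
  show "interlace ?\<nu> \<kappa>" unfolding interlace_def
  proof
    fix i
    have "j < ?\<nu> i" if "j < \<kappa> (Suc i)" for j
    proof -
      have "j < \<kappa> i" using antimonoD[OF \<kappa>, of i "Suc i"] that by simp
      moreover from this have "T (i, j) < T (Suc i, j)" "T (Suc i, j) \<le> Suc n"
        using ssytD[OF T] that by auto
      ultimately show ?thesis using ls by simp
    qed
    moreover have "j < \<kappa> i" if "j < ?\<nu> i" for j using ls that by simp
    ultimately show "\<kappa> (Suc i) \<le> ?\<nu> i \<and> ?\<nu> i \<le> \<kappa> i" by (meson not_less less_irrefl)
  qed
  show "restrict T (shape ?\<nu>) \<in> ssyt ?\<nu> n"
    unfolding ssyt_def
  proof (intro CollectI conjI allI impI)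
    show "restrict T (shape ?\<nu>) \<in> shape ?\<nu> \<rightarrow>\<^sub>E {1..n}"
      using ssytD(2)[OF T] ls by (auto simp: restrict_PiE_iff)
  next
    fix i j j' assume j: "j < j' \<and> j' < ?\<nu> i"
    then have "j < ?\<nu> i" by simp
    with j show "restrict T (shape ?\<nu>) (i, j) \<le> restrict T (shape ?\<nu>) (i, j')"
      using ssytD(4)[OF T] ls by simp
  next
    fix i i' j assume j: "i < i' \<and> j < ?\<nu> i \<and> j < ?\<nu> i'"
    then show "restrict T (shape ?\<nu>) (i, j) < restrict T (shape ?\<nu>) (i', j)"
      using ssytD(5)[OF T] ls by simp
  qed
qed

text \<open>The inverse of the restriction. Columns stay strict because the boxes filled with
  \<open>Suc n\<close> form a horizontal strip.\<close>

lemma ssyt_extend: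
  assumes il: "interlace \<nu> \<kappa>" and T: "T \<in> ssyt \<nu> n"
  defines "T' \<equiv> \<lambda>b. if b \<in> shape \<nu> then T b else if b \<in> shape \<kappa> then Suc n else undefined"
  shows "T' \<in> ssyt \<kappa> (Suc n)" and "small_shape \<kappa> n T' = \<nu>" and "restrict T' (shape \<nu>) = T"
proof -
  note le = interlaceD(2)[OF il]
  have inT: "T' (i, j) = T (i, j)" "T (i, j) \<le> n" "1 \<le> T (i, j)" if "j < \<nu> i" for i j
    using ssytD(2,3)[OF T that] that by (simp_all add: T'_def)
  have outT: "T' (i, j) = Suc n" if "\<not> j < \<nu> i" "j < \<kappa> i" for i j
    using that by (auto simp: T'_def)
  have "T' \<in> shape \<kappa> \<rightarrow>\<^sub>E {1..Suc n}"
  proof (rule PiE_I)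
    fix b assume "b \<in> shape \<kappa>"
    then obtain i j where b: "b = (i, j)" "j < \<kappa> i" by (cases b) auto
    show "T' b \<in> {1..Suc n}"
      by (cases "j < \<nu> i") (use b inT[of j i] outT[of j i] in auto)
  next
    fix b assume "b \<notin> shape \<kappa>"
    moreover from this have "b \<notin> shape \<nu>" by (cases b) (metis le mem_shape order.strict_trans2)
    ultimately show "T' b = undefined" by (simp add: T'_def)
  qed
  moreover have "T' (i, j) \<le> T' (i, j')" if "j < j'" "j' < \<kappa> i" for i j j'
  proof (cases "j' < \<nu> i")
    case True
    then show ?thesis using that inT(1)[of j i] inT(1)[of j' i] ssytD(4)[OF T that(1)] by simp
  next
    case False
    then show ?thesis using that inT[of j i] outT[of j' i] outT[of j i] by (cases "j < \<nu> i") auto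
  qed
  moreover have "T' (i, j) < T' (i', j)" if "i < i'" "j < \<kappa> i" "j < \<kappa> i'" for i i' j
  proof -
    \<comment> \<open>The upper of two boxes in one column lies in \<nu>, so it is never filled with
      \<open>Suc n\<close>.\<close>
    have "\<kappa> i' \<le> \<kappa> (Suc i)" using antimonoD[OF interlace_antimono(2)[OF il], of "Suc i" i'] that(1) by simp
    then have j: "j < \<nu> i" using that interlaceD(1)[OF il, of i] by simp
    show ?thesis
    proof (cases "j < \<nu> i'")
      case True
      then show ?thesis using inT j ssytD(5)[OF T that(1)] by simp
    next
      case False
      then show ?thesis using inT[OF j] outT that by (simp add: less_Suc_eq_le)
    qed
  qed
  ultimately show *: "T' \<in> ssyt \<kappa> (Suc n)" unfolding ssyt_def by blast
  have "j < small_shape \<kappa> n T' i \<longleftrightarrow> j < \<nu> i" for i j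
    unfolding less_small_shape[OF *]
    by (cases "j < \<nu> i") (use inT outT le[of i] in auto)
  then have "{..<small_shape \<kappa> n T' i} = {..<\<nu> i}" for i unfolding lessThan_def by simp
  then show "small_shape \<kappa> n T' = \<nu>" by (simp add: fun_eq_iff)
  show "restrict T' (shape \<nu>) = T"
  proof
    show "restrict T' (shape \<nu>) b = T b" for b
      using PiE_arb[OF ssytD(1)[OF T], of b] by (simp add: T'_def)
  qed
qed

text \<open>A tableau corresponds to the pair of the shape \<nu> of its entries up to
  \<open>n\<close> and its restriction to \<nu>. The remaining boxes all contain
  \<open>Suc n\<close> and contribute the power of the last variable.\<close>

lemma sum_ssyt_branching:
  fixes x :: "nat \<Rightarrow> 'a::comm_ring_1"
  assumes \<kappa>: "antimono \<kappa>" and supp: "\<forall>i\<ge>N. \<kappa> i = 0"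
  shows "(\<Sum>T\<in>ssyt \<kappa> (Suc n). \<Prod>b\<in>shape \<kappa>. x (T b))
    = (\<Sum>\<nu> | interlace \<nu> \<kappa>. x (Suc n) ^ (sum \<kappa> {..<N} - sum \<nu> {..<N})
        * (\<Sum>T\<in>ssyt \<nu> n. \<Prod>b\<in>shape \<nu>. x (T b)))"
proof -
  have supp': "\<forall>i\<ge>N. \<nu> i = 0" if "interlace \<nu> \<kappa>" for \<nu>
    using interlaceD(2)[OF that] supp by (metis le_zero_eq)
  have "\<nu> i \<le> \<kappa> 0" if "interlace \<nu> \<kappa>" for \<nu> i
    using interlaceD(2)[OF that, of i] antimonoD[OF \<kappa>, of 0 i] by simp
  with supp' have fin: "finite {\<nu>. interlace \<nu> \<kappa>}"
    by (intro finite_subset[OF _ finite_bounded_supported[of "\<kappa> 0" N]]) auto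
  let ?ext = "\<lambda>(\<nu>, T). \<lambda>b. if b \<in> shape \<nu> then T b else if b \<in> shape \<kappa> then Suc n else undefined"
  let ?res = "\<lambda>T. (small_shape \<kappa> n T, restrict T (shape (small_shape \<kappa> n T)))"
  have "(\<Sum>T\<in>ssyt \<kappa> (Suc n). \<Prod>b\<in>shape \<kappa>. x (T b))
    = (\<Sum>(\<nu>, T)\<in>Sigma {\<nu>. interlace \<nu> \<kappa>} (\<lambda>\<nu>. ssyt \<nu> n).
        x (Suc n) ^ (sum \<kappa> {..<N} - sum \<nu> {..<N}) * (\<Prod>b\<in>shape \<nu>. x (T b)))"
  proof (rule sum.reindex_bij_witness[where i = ?ext and j = ?res])
    fix T assume T: "T \<in> ssyt \<kappa> (Suc n)"
    let ?\<nu> = "small_shape \<kappa> n T"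
    note ls = less_small_shape[OF T, of _ n]
    note r = ssyt_restrict[OF \<kappa> T]
    have big: "T (i, j) = Suc n" if "j < \<kappa> i" "\<not> j < ?\<nu> i" for i j
      using ssytD(3)[OF T that(1)] that ls by simp
    show "?ext (?res T) = T"
    proof
      fix b :: "nat \<times> nat"
      obtain i j where b: "b = (i, j)" by (cases b)
      show "?ext (?res T) b = T b"
        using big[of j i] PiE_arb[OF ssytD(1)[OF T], of b] by (auto simp: b)
    qed
    show "?res T \<in> Sigma {\<nu>. interlace \<nu> \<kappa>} (\<lambda>\<nu>. ssyt \<nu> n)" using r by simp
    have sub: "shape ?\<nu> \<subseteq> shape \<kappa>" using ls by (auto simp: shape_def)
    have "(\<Prod>b\<in>shape \<kappa>. x (T b)) = (\<Prod>b\<in>shape \<kappa> - shape ?\<nu>. x (T b)) * (\<Prod>b\<in>shape ?\<nu>. x (T b))"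
      by (rule prod.subset_diff[OF sub finite_shape[OF supp]])
    also have "(\<Prod>b\<in>shape \<kappa> - shape ?\<nu>. x (T b)) = (\<Prod>b\<in>shape \<kappa> - shape ?\<nu>. x (Suc n))"
      using big by (intro prod.cong) auto
    also have "\<dots> = x (Suc n) ^ (sum \<kappa> {..<N} - sum ?\<nu> {..<N})"
      using card_Diff_subset[OF finite_shape[OF supp'[OF r(1)]] sub]
        card_shape[OF supp] card_shape[OF supp'[OF r(1)]] by simp
    finally show "(case ?res T of (\<nu>, T) \<Rightarrow>
        x (Suc n) ^ (sum \<kappa> {..<N} - sum \<nu> {..<N}) * (\<Prod>b\<in>shape \<nu>. x (T b)))
        = (\<Prod>b\<in>shape \<kappa>. x (T b))" by simp
  next
    fix p assume "p \<in> Sigma {\<nu>. interlace \<nu> \<kappa>} (\<lambda>\<nu>. ssyt \<nu> n)"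
    then obtain \<nu> T where p: "p = (\<nu>, T)" "interlace \<nu> \<kappa>" "T \<in> ssyt \<nu> n" by auto
    show "?res (?ext p) = p" "?ext p \<in> ssyt \<kappa> (Suc n)"
      using ssyt_extend[OF p(2,3)] p(1) by simp_all
  qed
  also have "\<dots> = (\<Sum>\<nu> | interlace \<nu> \<kappa>. \<Sum>T\<in>ssyt \<nu> n.
        x (Suc n) ^ (sum \<kappa> {..<N} - sum \<nu> {..<N}) * (\<Prod>b\<in>shape \<nu>. x (T b)))"
    using fin supp' by (subst sum.Sigma) (auto intro!: finite_ssyt finite_shape)
  finally show ?thesis by (simp add: sum_distrib_left)
qed

theorem sum_ssyt_eq_branch_schur:
  assumes "antimono \<kappa>" and "\<forall>i\<ge>N. \<kappa> i = 0"
  shows "(\<Sum>T\<in>ssyt \<kappa> n. \<Prod>b\<in>shape \<kappa>. x (T b)) = branch_schur N x n \<kappa>"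
  using assms
proof (induction n arbitrary: \<kappa>)
  case 0
  show ?case
  proof (cases "\<forall>i. \<kappa> i = 0")
    case True
    then have "shape \<kappa> = {}" by (auto simp: shape_def)
    \<comment> \<open>The empty shape has exactly one filling, the function that is undefined
      everywhere; it contributes the empty product 1.\<close>
    moreover from this True have "ssyt \<kappa> 0 = {\<lambda>_. undefined}" by (auto simp: ssyt_def)
    ultimately have "(\<Sum>T\<in>ssyt \<kappa> 0. \<Prod>b\<in>shape \<kappa>. x (T b)) = 1" by simp
    moreover have "branch_schur N x 0 \<kappa> = 1" using True by simp
    ultimately show ?thesis by (simp only:)
  next
    case False
    then obtain i where "0 < \<kappa> i" by auto
    then have "ssyt \<kappa> 0 = {}" using ssytD(2,3)[of _ \<kappa> 0 0 i] by fastforce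
    then show ?thesis using False by simp
  qed
next
  case (Suc n)
  have "(\<Sum>T\<in>ssyt \<nu> n. \<Prod>b\<in>shape \<nu>. x (T b)) = branch_schur N x n \<nu>" if "interlace \<nu> \<kappa>" for \<nu>
    using Suc.IH[OF interlace_antimono(1)[OF that]] interlaceD(2)[OF that] Suc.prems(2)
    by (metis le_zero_eq)
  then show ?case unfolding sum_ssyt_branching[OF Suc.prems] by (auto intro!: sum.cong)
qed

section \<open>Partitions as lists and as functions\<close>

definition row_lengths :: "nat list \<Rightarrow> nat \<Rightarrow> nat" where
  "row_lengths \<mu> i = (if i < length \<mu> then \<mu> ! i else 0)"

lemma diagram_eq_shape: "diagram \<mu> = shape (row_lengths \<mu>)"
  by (auto simp: diagram_def shape_def row_lengths_def split: if_splits)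

lemma SSYT_eq_ssyt: "SSYT \<mu> n = ssyt (row_lengths \<mu>) n"
  unfolding SSYT_def ssyt_def diagram_eq_shape mem_shape by (auto dest: less_trans)

definition partition_funs :: "nat \<Rightarrow> nat \<Rightarrow> (nat \<Rightarrow> nat) set" where
  "partition_funs N k = {\<kappa>. antimono \<kappa> \<and> (\<forall>i\<ge>N. \<kappa> i = 0) \<and> sum \<kappa> {..<N} = k}"

lemma partition_funsD:
  assumes "\<kappa> \<in> partition_funs N k"
  shows "antimono \<kappa>" "\<forall>i\<ge>N. \<kappa> i = 0" "sum \<kappa> {..<N} = k"
  using assms by (auto simp: partition_funs_def)

lemma finite_partition_funs: "finite (partition_funs N k)"
proof (rule finite_subset[OF _ finite_bounded_supported[of k N]])
  have "\<kappa> i \<le> sum \<kappa> {..<N}" if "\<forall>i\<ge>N. \<kappa> i = 0" for \<kappa> :: "nat \<Rightarrow> nat" and i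
    by (cases "i < N") (use that in \<open>auto intro: member_le_sum\<close>)
  then show "partition_funs N k \<subseteq> {\<nu>. (\<forall>i. \<nu> i \<le> k) \<and> (\<forall>i\<ge>N. \<nu> i = 0)}"
    unfolding partition_funs_def by blast
qed

text \<open>A partition of \<open>k\<close> has at most \<open>k\<close> parts, so for
  \<open>k \<le> N\<close> the bound on the number of rows excludes none.\<close>

lemma bij_betw_row_lengths:
  assumes "k \<le> N"
  shows "bij_betw row_lengths (partitions_of k) (partition_funs N k)"
  unfolding bij_betw_def
proof
  \<comment> \<open>Parts are positive, so the length of the list can be recovered from the
    function; this gives injectivity.\<close>
  have pos: "0 < row_lengths \<mu> i \<longleftrightarrow> i < length \<mu>" if "\<mu> \<in> partitions_of k" for \<mu> i
    using that by (auto simp: partitions_of_def is_partition_def row_lengths_def Suc_le_eq dest: nth_mem)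
  show "inj_on row_lengths (partitions_of k)"
  proof (rule inj_onI)
    fix \<mu> \<nu> assume a: "\<mu> \<in> partitions_of k" "\<nu> \<in> partitions_of k" "row_lengths \<mu> = row_lengths \<nu>"
    then have "i < length \<mu> \<longleftrightarrow> i < length \<nu>" for i using pos by metis
    then have len: "length \<mu> = length \<nu>" by (meson linorder_neqE_nat less_irrefl)
    show "\<mu> = \<nu>"
    proof (rule nth_equalityI[OF len])
      show "\<mu> ! i = \<nu> ! i" if "i < length \<mu>" for i
        using fun_cong[OF a(3), of i] that len by (simp add: row_lengths_def)
    qed
  qed
  have into: "row_lengths \<mu> \<in> partition_funs N k" if \<mu>: "\<mu> \<in> partitions_of k" for \<mu>
  proof -
    have ge1: "\<forall>m\<in>set \<mu>. m \<ge> 1" and sorted: "sorted_wrt (\<ge>) \<mu>" and k: "sum_list \<mu> = k"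
      using \<mu> by (auto simp: partitions_of_def is_partition_def)
    have "length \<mu> \<le> sum_list \<mu>" using ge1 by (induction \<mu>) auto
    with k assms have len: "length \<mu> \<le> N" by simp
    have "antimono (row_lengths \<mu>)" unfolding antimono_iff_le_Suc
      using sorted by (auto simp: row_lengths_def sorted_wrt_iff_nth_less)
    moreover have "\<forall>i\<ge>N. row_lengths \<mu> i = 0" using len by (auto simp: row_lengths_def)
    moreover have "sum (row_lengths \<mu>) {..<N} = sum (\<lambda>i. \<mu> ! i) {..<length \<mu>}"
      using len by (intro sum.mono_neutral_cong_right) (auto simp: row_lengths_def)
    then have "sum (row_lengths \<mu>) {..<N} = k" using k by (simp add: sum_list_sum_nth lessThan_atLeast0)
    ultimately show ?thesis by (simp add: partition_funs_def)
  qed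
  have onto: "\<kappa> \<in> row_lengths ` partitions_of k" if \<kappa>: "\<kappa> \<in> partition_funs N k" for \<kappa>
  proof -
    note p = partition_funsD[OF \<kappa>]
    \<comment> \<open>The number of nonempty rows; cutting the function off there yields the
      list.\<close>
    define c where "c = (LEAST c. \<kappa> c = 0)"
    have "\<kappa> c = 0" unfolding c_def by (rule LeastI[of _ N]) (use p(2) in simp)
    then have zero: "\<kappa> i = 0" if "c \<le> i" for i using antimonoD[OF p(1) that] by simp
    have pos: "\<kappa> i > 0" if "i < c" for i using not_less_Least that unfolding c_def by blast
    have "c \<le> N" unfolding c_def by (rule Least_le) (use p(2) in simp)
    define \<mu> where "\<mu> = map \<kappa> [0..<c]"
    have eq: "row_lengths \<mu> = \<kappa>" using zero by (auto simp: row_lengths_def \<mu>_def fun_eq_iff)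
    have "sum \<kappa> {..<c} = sum \<kappa> {..<N}"
      using \<open>c \<le> N\<close> zero by (intro sum.mono_neutral_left) auto
    then have "sum_list \<mu> = k"
      using p(3) by (simp add: \<mu>_def interv_sum_list_conv_sum_set_nat lessThan_atLeast0)
    moreover have "sorted_wrt (\<ge>) \<mu>"
      using antimonoD[OF p(1)] by (simp add: \<mu>_def sorted_wrt_iff_nth_less)
    moreover have "\<forall>m\<in>set \<mu>. m \<ge> 1" using pos by (auto simp: \<mu>_def Suc_le_eq)
    ultimately have "\<mu> \<in> partitions_of k" by (simp add: partitions_of_def is_partition_def)
    with eq show ?thesis by blast
  qed
  show "row_lengths ` partitions_of k = partition_funs N k" using into onto by blast
qed

lemma schur_eq_branch_schur:
  assumes "row_lengths \<mu> \<in> partition_funs N k"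
  shows "schur \<mu> n x = branch_schur N x n (row_lengths \<mu>)"
  using sum_ssyt_eq_branch_schur partition_funsD[OF assms]
  by (simp add: schur_def SSYT_eq_ssyt diagram_eq_shape)

section \<open>Elementary symmetric polynomials\<close>

text \<open>The function form of the partition with \<open>k\<close> parts equal to 1, whose Schur
  polynomial is the elementary symmetric polynomial of degree \<open>k\<close>.\<close>

definition one_column :: "nat \<Rightarrow> nat \<Rightarrow> nat" where
  "one_column k i = of_bool (i < k)"

lemma sum_one_column: "k \<le> N \<Longrightarrow> sum (one_column k) {..<N} = k"
proof -
  assume "k \<le> N"
  then have "{..<N} \<inter> {i. i < k} = {..<k}" by auto
  then show ?thesis by (simp add: one_column_def)
qed

lemma one_column_partition_funs: "k \<le> N \<Longrightarrow> one_column k \<in> partition_funs N k"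
  by (simp add: partition_funs_def sum_one_column) (auto simp: one_column_def antimono_def)

lemma row_lengths_replicate_1: "row_lengths (replicate k 1) = one_column k"
  by (auto simp: row_lengths_def one_column_def fun_eq_iff)

lemma branch_schur_one_column_0: "branch_schur N x n (one_column 0) = 1"
proof (induction n)
  case (Suc n)
  have "{\<nu>. interlace \<nu> (one_column 0)} = {one_column 0}"
    by (auto simp: interlace_def one_column_def fun_eq_iff)
  with Suc show ?case by simp
qed (simp add: one_column_def)

text \<open>A horizontal strip inside a single column is empty or consists of the lowest box, so
  only two shapes interlace. This is the usual recursion for elementary symmetric
  polynomials.\<close>

lemma branch_schur_one_column_Suc:
  assumes "Suc k \<le> N"
  shows "branch_schur N x (Suc n) (one_column (Suc k))
    = branch_schur N x n (one_column (Suc k)) + x (Suc n) * branch_schur N x n (one_column k)"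
proof -
  have "\<nu> = one_column k \<or> \<nu> = one_column (Suc k)" if "interlace \<nu> (one_column (Suc k))" for \<nu>
  proof -
    have 1: "\<nu> i = one_column k i" if "i \<noteq> k" for i
      using interlaceD[OF \<open>interlace \<nu> _\<close>, of i] that by (auto simp: one_column_def split: if_splits)
    have 2: "\<nu> k = 0 \<or> \<nu> k = 1" using interlaceD(2)[OF that, of k] by (auto simp: one_column_def)
    from 2 show ?thesis
    proof
      assume "\<nu> k = 0"
      then have "\<nu> i = one_column k i" for i using 1 by (cases "i = k") (auto simp: one_column_def)
      then show ?thesis by blast
    next
      assume "\<nu> k = 1"
      then have "\<nu> i = one_column (Suc k) i" for i
        using 1 by (cases "i = k") (auto simp: one_column_def)
      then show ?thesis by blast
    qed
  qed
  moreover have "interlace (one_column k) (one_column (Suc k))"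
    "interlace (one_column (Suc k)) (one_column (Suc k))"
    by (auto simp: interlace_def one_column_def)
  ultimately have "{\<nu>. interlace \<nu> (one_column (Suc k))} = {one_column k, one_column (Suc k)}"
    by blast
  moreover have "one_column k k \<noteq> one_column (Suc k) k" by (simp add: one_column_def)
  then have "one_column k \<noteq> one_column (Suc k)" by metis
  ultimately show ?thesis using assms by (simp add: sum_one_column)
qed

lemma branch_schur_one_column_eq_0: "n < k \<Longrightarrow> branch_schur N x n (one_column k) = 0"
  by (rule branch_schur_eq_0) (simp add: one_column_def)

text \<open>In the product over a \<open>k\<close>-subset, choose the \<open>j\<close> indices that
  contribute \<open>- x i\<close>; each choice extends to a \<open>k\<close>-subset in
  \<open>(n - j) choose (k - j)\<close> ways. The proof uses Pascal's rule by induction on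
  \<open>n\<close>. Here \<open>y\<close> is arbitrary, since the sum of the variables would change
  with \<open>n\<close>.\<close>

lemma branch_schur_one_column_diff:
  fixes x :: "nat \<Rightarrow> 'a::comm_ring_1"
  assumes "k \<le> N"
  shows "branch_schur N (\<lambda>i. y - x i) n (one_column k)
    = (\<Sum>j\<le>k. (- 1) ^ j * of_nat ((n - j) choose (k - j)) * y ^ (k - j) * branch_schur N x n (one_column j))"
  using assms
proof (induction n arbitrary: k)
  case 0
  have "(\<Sum>j\<le>k. (- 1) ^ j * of_nat ((0 - j) choose (k - j)) * y ^ (k - j) * branch_schur N x 0 (one_column j))
      = (\<Sum>j\<in>{0}. (- 1) ^ j * of_nat ((0 - j) choose (k - j)) * y ^ (k - j) * branch_schur N x 0 (one_column j))"
    by (rule sum.mono_neutral_right) (auto simp: branch_schur_one_column_eq_0 simp del: branch_schur.simps)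
  then show ?case
    by (cases k) (simp_all add: branch_schur_one_column_0 branch_schur_one_column_eq_0 del: branch_schur.simps)
next
  case (Suc n)
  show ?case
  proof (cases k)
    case 0
    then show ?thesis by (simp add: branch_schur_one_column_0 del: branch_schur.simps)
  next
    case k: (Suc m)
    let ?e = "\<lambda>j. branch_schur N x n (one_column j)"
    \<comment> \<open>Pascal's rule with its boundary cases: for \<open>j > n\<close> the factor
      \<open>?e j\<close> vanishes, and for \<open>j > m\<close> the binomials on both sides have
      lower index 0.\<close>
    have pascal: "of_nat ((Suc n - j) choose (Suc m - j)) * ?e j
        = of_nat ((n - j) choose (Suc m - j)) * ?e j + of_bool (j \<le> m) * of_nat ((n - j) choose (m - j)) * ?e j" for j
    proof -
      consider "j \<le> n" "j \<le> m" | "j > n" | "j > m" "j \<le> n" by linarith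
      then show ?thesis
      proof cases
        case 1
        then show ?thesis by (simp add: Suc_diff_le distrib_right)
      next
        case 2
        then show ?thesis by (simp add: branch_schur_one_column_eq_0)
      next
        case 3
        then show ?thesis by simp
      qed
    qed
    let ?c = "\<lambda>j. (- 1) ^ j * y ^ (Suc m - j)"
    let ?E = "\<lambda>j. branch_schur N x (Suc n) (one_column j)"
    have E: "?E (Suc j) = ?e (Suc j) + x (Suc n) * ?e j" if "j \<le> m" for j
      using branch_schur_one_column_Suc[of j N x n] that k Suc.prems by simp
    \<comment> \<open>The recursion splits each \<open>?E j\<close> with \<open>j > 0\<close>; the
      parts containing \<open>x (Suc n)\<close> are collected in the last sum, with the index
      shifted by one.\<close>
    have "(\<Sum>j\<le>Suc m. (- 1) ^ j * of_nat ((Suc n - j) choose (Suc m - j)) * y ^ (Suc m - j) * ?E j)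
      = ?c 0 * (of_nat (Suc n choose Suc m) * ?e 0)
        + (\<Sum>j\<le>m. ?c (Suc j) * (of_nat ((Suc n - Suc j) choose (Suc m - Suc j)) * ?e (Suc j)))
        + (\<Sum>j\<le>m. ?c (Suc j) * of_nat ((n - j) choose (m - j)) * (x (Suc n) * ?e j))"
      unfolding sum.atMost_Suc_shift
      by (simp add: E sum.distrib[symmetric] branch_schur_one_column_0 del: branch_schur.simps binomial_Suc_Suc)
        (simp add: algebra_simps del: branch_schur.simps binomial_Suc_Suc)
    also have "?c 0 * (of_nat (Suc n choose Suc m) * ?e 0)
        + (\<Sum>j\<le>m. ?c (Suc j) * (of_nat ((Suc n - Suc j) choose (Suc m - Suc j)) * ?e (Suc j)))
        = (\<Sum>j\<le>Suc m. ?c j * (of_nat ((Suc n - j) choose (Suc m - j)) * ?e j))"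
      unfolding sum.atMost_Suc_shift by simp
    also have "\<dots> = (\<Sum>j\<le>Suc m. ?c j * (of_nat ((n - j) choose (Suc m - j)) * ?e j))
        + (\<Sum>j\<le>Suc m. ?c j * (of_bool (j \<le> m) * of_nat ((n - j) choose (m - j)) * ?e j))"
      unfolding pascal distrib_left sum.distrib ..
    also have "(\<Sum>j\<le>Suc m. ?c j * (of_nat ((n - j) choose (Suc m - j)) * ?e j))
        = branch_schur N (\<lambda>i. y - x i) n (one_column (Suc m))"
      using Suc.prems k by (subst Suc.IH) (auto intro!: sum.cong simp: mult_ac)
    also have "(\<Sum>j\<le>Suc m. ?c j * (of_bool (j \<le> m) * of_nat ((n - j) choose (m - j)) * ?e j))
        = (\<Sum>j\<le>m. y * ((- 1) ^ j * of_nat ((n - j) choose (m - j)) * y ^ (m - j) * ?e j))"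
      by (simp add: Suc_diff_le mult_ac)
    also have "\<dots> = y * branch_schur N (\<lambda>i. y - x i) n (one_column m)"
      using Suc.prems k by (subst Suc.IH) (auto simp: sum_distrib_left)
    also have "(\<Sum>j\<le>m. ?c (Suc j) * of_nat ((n - j) choose (m - j)) * (x (Suc n) * ?e j))
        = (\<Sum>j\<le>m. - x (Suc n) * ((- 1) ^ j * of_nat ((n - j) choose (m - j)) * y ^ (m - j) * ?e j))"
      by (simp add: mult_ac)
    also have "\<dots> = - x (Suc n) * branch_schur N (\<lambda>i. y - x i) n (one_column m)"
      using Suc.prems k by (subst Suc.IH) (auto simp: sum_distrib_left)
    finally have expansion: "(\<Sum>j\<le>Suc m. (- 1) ^ j * of_nat ((Suc n - j) choose (Suc m - j)) * y ^ (Suc m - j) * ?E j)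
        = branch_schur N (\<lambda>i. y - x i) n (one_column (Suc m))
          + y * branch_schur N (\<lambda>i. y - x i) n (one_column m)
          + - x (Suc n) * branch_schur N (\<lambda>i. y - x i) n (one_column m)" .
    show ?thesis
      unfolding k expansion using branch_schur_one_column_Suc[of m N "\<lambda>i. y - x i" n] Suc.prems k
      by (simp add: algebra_simps del: branch_schur.simps)
  qed
qed

section \<open>Fillings with a prescribed start of the first column\<close>

definition syt :: "(nat \<Rightarrow> nat) \<Rightarrow> nat \<Rightarrow> (nat \<times> nat \<Rightarrow> nat) set" where
  "syt \<kappa> n = {T \<in> shape \<kappa> \<rightarrow>\<^sub>E {1..n}. inj_on T (shape \<kappa>) \<and>
     (\<forall>i j j'. j < j' \<and> j' < \<kappa> i \<longrightarrow> T (i, j) < T (i, j')) \<and>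
     (\<forall>i i' j. i < i' \<and> j < \<kappa> i \<and> j < \<kappa> i' \<longrightarrow> T (i, j) < T (i', j))}"

lemma sytD:
  assumes "T \<in> syt \<kappa> n"
  shows "T \<in> shape \<kappa> \<rightarrow>\<^sub>E {1..n}" and "inj_on T (shape \<kappa>)"
    and "j < \<kappa> i \<Longrightarrow> 1 \<le> T (i, j)" and "j < \<kappa> i \<Longrightarrow> T (i, j) \<le> n"
    and "j < j' \<Longrightarrow> j' < \<kappa> i \<Longrightarrow> T (i, j) < T (i, j')"
    and "i < i' \<Longrightarrow> j < \<kappa> i \<Longrightarrow> j < \<kappa> i' \<Longrightarrow> T (i, j) < T (i', j)"
proof -
  show 1: "T \<in> shape \<kappa> \<rightarrow>\<^sub>E {1..n}" using assms by (auto simp: syt_def)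
  show "1 \<le> T (i, j)" "T (i, j) \<le> n" if "j < \<kappa> i"
    using PiE_mem[OF 1, of "(i, j)"] that by auto
  show "inj_on T (shape \<kappa>)" using assms by (simp add: syt_def)
  show "j < j' \<Longrightarrow> j' < \<kappa> i \<Longrightarrow> T (i, j) < T (i, j')" using assms by (simp add: syt_def)
  show "i < i' \<Longrightarrow> j < \<kappa> i \<Longrightarrow> j < \<kappa> i' \<Longrightarrow> T (i, j) < T (i', j)"
    using assms by (simp add: syt_def)
qed

lemma finite_syt: "finite (shape \<kappa>) \<Longrightarrow> finite (syt \<kappa> n)"
  unfolding syt_def by (simp add: finite_PiE)

lemma SYT_eq_syt: "SYT \<mu> n = syt (row_lengths \<mu>) n"
  unfolding SYT_def syt_def diagram_eq_shape mem_shape by (auto dest: less_trans)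

definition column_0 :: "(nat \<Rightarrow> nat) \<Rightarrow> (nat \<times> nat \<Rightarrow> nat) \<Rightarrow> nat set" where
  "column_0 \<kappa> T = {T (i, 0) |i. 0 < \<kappa> i}"

lemma column_0_subset: "column_0 \<kappa> T \<subseteq> T ` shape \<kappa>"
  by (auto simp: column_0_def)

text \<open>These sets decrease in \<open>j\<close>: if \<open>m\<close> is the smallest positive
  number missing in the first column, the filling belongs to exactly those with
  \<open>j < m\<close>.\<close>

definition initial_syt :: "nat \<Rightarrow> (nat \<Rightarrow> nat) \<Rightarrow> nat \<Rightarrow> (nat \<times> nat \<Rightarrow> nat) set" where
  "initial_syt j \<kappa> n = {T \<in> syt \<kappa> n. {1..j} \<subseteq> column_0 \<kappa> T}"

text \<open>The first column would need more different entries than the shape has boxes.\<close>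

lemma initial_syt_eq_empty:
  assumes "\<kappa> \<in> partition_funs N k" and "k < j"
  shows "initial_syt j \<kappa> n = {}"
proof -
  note p = partition_funsD[OF assms(1)]
  have "\<not> {1..j} \<subseteq> column_0 \<kappa> T" for T
  proof
    assume "{1..j} \<subseteq> column_0 \<kappa> T"
    then have "{1..j} \<subseteq> T ` shape \<kappa>" using column_0_subset by blast
    from surj_card_le[OF finite_shape[OF p(2)] this] show False
      using card_shape[OF p(2)] p(3) assms(2) by simp
  qed
  then show ?thesis by (simp add: initial_syt_def)
qed

section \<open>Removing the largest entry from a corner box\<close>

context
  fixes \<kappa> :: "nat \<Rightarrow> nat" and i r :: nat
  assumes pos: "0 < \<kappa> i" and \<kappa>': "antimono (\<kappa>(i := \<kappa> i - 1))"
begin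

lemma shape_remove_box: "shape (\<kappa>(i := \<kappa> i - 1)) = shape \<kappa> - {(i, \<kappa> i - 1)}"
  using pos by (auto simp: shape_def split: if_splits)

lemma mem_shape_remove_box: "j < (\<kappa>(i := \<kappa> i - 1)) a \<longleftrightarrow> j < \<kappa> a \<and> (a, j) \<noteq> (i, \<kappa> i - 1)"
  using pos by auto

text \<open>Since \<open>j \<le> r\<close>, the deleted entry \<open>Suc r\<close> is not among
  those prescribed for the first column.\<close>

lemma initial_syt_remove_box:
  assumes T: "T \<in> initial_syt j \<kappa> (Suc r)" and max: "T (i, \<kappa> i - 1) = Suc r" and j: "j \<le> r"
  shows "restrict T (shape (\<kappa>(i := \<kappa> i - 1))) \<in> initial_syt j (\<kappa>(i := \<kappa> i - 1)) r"
proof -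
  let ?\<kappa> = "\<kappa>(i := \<kappa> i - 1)" and ?b = "(i, \<kappa> i - 1)"
  have T': "T \<in> syt \<kappa> (Suc r)" and col: "{1..j} \<subseteq> column_0 \<kappa> T"
    using T by (auto simp: initial_syt_def)
  note d = sytD[OF T']
  have le: "T b \<in> {1..r}" if "b \<in> shape ?\<kappa>" for b
  proof -
    have b: "b \<in> shape \<kappa>" "b \<noteq> ?b" using that shape_remove_box by auto
    then have "T b \<noteq> Suc r" using inj_onD[OF d(2), of b ?b] max pos by auto
    moreover have "T b \<in> {1..Suc r}" using PiE_mem[OF d(1) b(1)] .
    ultimately show ?thesis by auto
  qed
  have "restrict T (shape ?\<kappa>) \<in> syt ?\<kappa> r" unfolding syt_def
  proof (intro CollectI conjI allI impI)
    show "restrict T (shape ?\<kappa>) \<in> shape ?\<kappa> \<rightarrow>\<^sub>E {1..r}" using le by (simp add: restrict_PiE_iff)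
    show "inj_on (restrict T (shape ?\<kappa>)) (shape ?\<kappa>)"
      using inj_on_subset[OF d(2), of "shape ?\<kappa>"] shape_remove_box by (simp add: inj_on_restrict_eq)
  next
    fix a c c' assume c: "c < c' \<and> c' < ?\<kappa> a"
    then have "c < ?\<kappa> a" by (meson less_trans)
    moreover have "T (a, c) < T (a, c')" using d(5)[of c c' a] c mem_shape_remove_box by blast
    ultimately show "restrict T (shape ?\<kappa>) (a, c) < restrict T (shape ?\<kappa>) (a, c')"
      using c by (simp del: fun_upd_apply)
  next
    fix a a' c assume c: "a < a' \<and> c < ?\<kappa> a \<and> c < ?\<kappa> a'"
    then have "T (a, c) < T (a', c)" using d(6)[of a a' c] mem_shape_remove_box by blast
    then show "restrict T (shape ?\<kappa>) (a, c) < restrict T (shape ?\<kappa>) (a', c)"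
      using c by (simp del: fun_upd_apply)
  qed
  moreover have "m \<in> column_0 ?\<kappa> (restrict T (shape ?\<kappa>))" if m: "m \<in> {1..j}" for m
  proof -
    obtain a where a: "m = T (a, 0)" "0 < \<kappa> a" using col m by (auto simp: column_0_def)
    have "(a, 0) \<noteq> ?b" using a max m j by auto
    with a have "0 < ?\<kappa> a" using mem_shape_remove_box by blast
    then show ?thesis using a(1) unfolding column_0_def
      by (intro CollectI exI[of _ a]) (simp del: fun_upd_apply)
  qed
  ultimately show ?thesis by (auto simp: initial_syt_def)
qed

text \<open>The new entry exceeds all others and its box is a corner, so it only ever occurs as the
  larger side of a comparison.\<close>

lemma initial_syt_add_box:
  assumes T: "T \<in> initial_syt j (\<kappa>(i := \<kappa> i - 1)) r"
  shows "T((i, \<kappa> i - 1) := Suc r) \<in> initial_syt j \<kappa> (Suc r)"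
proof -
  let ?\<kappa> = "\<kappa>(i := \<kappa> i - 1)" and ?b = "(i, \<kappa> i - 1)"
  let ?T = "T(?b := Suc r)"
  have T': "T \<in> syt ?\<kappa> r" and col: "{1..j} \<subseteq> column_0 ?\<kappa> T"
    using T unfolding initial_syt_def by blast+
  note d = sytD[OF T']
  have shape: "shape \<kappa> = insert ?b (shape ?\<kappa>)" "?b \<notin> shape ?\<kappa>"
    unfolding shape_remove_box using pos by auto
  have in': "(a, c) = ?b \<or> c < ?\<kappa> a" if "c < \<kappa> a" for a c
    using mem_shape_remove_box that by blast
  have upd: "?T b = T b" if "b \<noteq> ?b" for b using that by simp
  have upd_b: "?T ?b = Suc r" by simp
  have lt: "T b < Suc r" if "b \<in> shape ?\<kappa>" for b
    using PiE_mem[OF d(1) that] by simp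
  have "?T \<in> syt \<kappa> (Suc r)" unfolding syt_def
  proof (intro CollectI conjI allI impI)
    show "?T \<in> shape \<kappa> \<rightarrow>\<^sub>E {1..Suc r}"
    proof (rule PiE_I)
      show "?T b \<in> {1..Suc r}" if b: "b \<in> shape \<kappa>" for b
      proof (cases "b = ?b")
        case False
        with b shape(1) have "T b \<in> {1..r}" using PiE_mem[OF d(1)] by blast
        then show ?thesis unfolding upd[OF False] by simp
      qed simp
      show "?T b = undefined" if b: "b \<notin> shape \<kappa>" for b
      proof -
        have "b \<noteq> ?b" "b \<notin> shape ?\<kappa>" using b shape(1) by blast+
        then show ?thesis using PiE_arb[OF d(1)] upd by metis
      qed
    qed
    show "inj_on ?T (shape \<kappa>)"
      unfolding shape(1)
    proof (rule inj_on_insert[THEN iffD2], intro conjI)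
      show "inj_on ?T (shape ?\<kappa>)"
        using d(2) shape(2) inj_on_cong[of "shape ?\<kappa>" ?T T] upd by metis
      show "?T ?b \<notin> ?T ` (shape ?\<kappa> - {?b})"
      proof
        assume "?T ?b \<in> ?T ` (shape ?\<kappa> - {?b})"
        then obtain b where "?T ?b = ?T b" "b \<in> shape ?\<kappa>" "b \<noteq> ?b" by blast
        then have "T b = Suc r" using upd upd_b by metis
        with lt[OF \<open>b \<in> shape ?\<kappa>\<close>] show False by simp
      qed
    qed
  next
    fix a c c' assume c: "c < c' \<and> c' < \<kappa> a"
    then have "(a, c) \<noteq> ?b" by auto
    moreover have "c < \<kappa> a" using c by simp
    ultimately have 1: "c < ?\<kappa> a" using in' by blast
    show "?T (a, c) < ?T (a, c')"
    proof (cases "(a, c') = ?b")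
      case True
      show ?thesis unfolding True upd_b upd[OF \<open>(a, c) \<noteq> ?b\<close>] by (rule lt) (use 1 in simp)
    next
      case False
      then have "c' < ?\<kappa> a" using in' c by blast
      with d(5) c show ?thesis unfolding upd[OF False] upd[OF \<open>(a, c) \<noteq> ?b\<close>] by blast
    qed
  next
    fix a a' c assume c: "a < a' \<and> c < \<kappa> a \<and> c < \<kappa> a'"
    \<comment> \<open>A box below the new one would make row \<open>a'\<close> longer than row
      \<open>i\<close> of the smaller shape, which is antimono.\<close>
    have "(a, c) \<noteq> ?b"
    proof
      assume "(a, c) = ?b"
      moreover have "?\<kappa> a' \<le> ?\<kappa> a" using antimonoD[OF \<kappa>', of a a'] c by simp
      ultimately show False using c by auto
    qed
    then have 1: "c < ?\<kappa> a" using in' c by blast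
    show "?T (a, c) < ?T (a', c)"
    proof (cases "(a', c) = ?b")
      case True
      show ?thesis unfolding True upd_b upd[OF \<open>(a, c) \<noteq> ?b\<close>] by (rule lt) (use 1 in simp)
    next
      case False
      then have "c < ?\<kappa> a'" using in' c by blast
      with d(6) c 1 show ?thesis unfolding upd[OF False] upd[OF \<open>(a, c) \<noteq> ?b\<close>] by blast
    qed
  qed
  moreover have "m \<in> column_0 \<kappa> ?T" if m: "m \<in> {1..j}" for m
  proof -
    obtain a where a: "m = T (a, 0)" "0 < ?\<kappa> a" using col m unfolding column_0_def by blast
    then have "(a, 0) \<noteq> ?b" "0 < \<kappa> a" using mem_shape_remove_box by blast+
    then have "m = ?T (a, 0)" using a(1) upd by metis
    with \<open>0 < \<kappa> a\<close> show ?thesis unfolding column_0_def by blast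
  qed
  ultimately show ?thesis unfolding initial_syt_def by blast
qed

lemma card_initial_syt_max_at:
  assumes "j \<le> r"
  shows "card {T \<in> initial_syt j \<kappa> (Suc r). T (i, \<kappa> i - 1) = Suc r}
    = card (initial_syt j (\<kappa>(i := \<kappa> i - 1)) r)"
proof (rule bij_betw_same_card)
  let ?\<kappa> = "\<kappa>(i := \<kappa> i - 1)" and ?b = "(i, \<kappa> i - 1)"
  let ?A = "{T \<in> initial_syt j \<kappa> (Suc r). T ?b = Suc r}"
  show "bij_betw (\<lambda>T. restrict T (shape ?\<kappa>)) ?A (initial_syt j ?\<kappa> r)"
  proof (rule bij_betw_byWitness[where f' = "\<lambda>T. T(?b := Suc r)"])
    have "(restrict T (shape ?\<kappa>))(?b := Suc r) = T" if "T \<in> ?A" for T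
    proof
      fix b
      have "T \<in> shape \<kappa> \<rightarrow>\<^sub>E {1..Suc r}" using that sytD(1) by (auto simp: initial_syt_def)
      then show "((restrict T (shape ?\<kappa>))(?b := Suc r)) b = T b"
        using that PiE_arb[of T "shape \<kappa>" _ b] unfolding shape_remove_box by (auto simp: restrict_def)
    qed
    then show "\<forall>T\<in>?A. (restrict T (shape ?\<kappa>))(?b := Suc r) = T" by blast
    have "restrict (T(?b := Suc r)) (shape ?\<kappa>) = T" if "T \<in> initial_syt j ?\<kappa> r" for T
    proof
      fix b
      have "T \<in> shape ?\<kappa> \<rightarrow>\<^sub>E {1..r}" using that sytD(1) unfolding initial_syt_def by blast
      then show "restrict (T(?b := Suc r)) (shape ?\<kappa>) b = T b"
        using PiE_arb[of T "shape ?\<kappa>" _ b] unfolding shape_remove_box by (auto simp: restrict_def)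
    qed
    then show "\<forall>T\<in>initial_syt j ?\<kappa> r. restrict (T(?b := Suc r)) (shape ?\<kappa>) = T" by blast
    show "(\<lambda>T. restrict T (shape ?\<kappa>)) ` ?A \<subseteq> initial_syt j ?\<kappa> r"
      using initial_syt_remove_box assms by blast
    show "(\<lambda>T. T(?b := Suc r)) ` initial_syt j ?\<kappa> r \<subseteq> ?A"
      using initial_syt_add_box by auto
  qed
qed

end

text \<open>Fillings are classified by the place of the entry \<open>Suc r\<close>: it is absent, or
  it sits in a box whose removal leaves a partition. Injectivity makes the classes disjoint.\<close>

lemma card_initial_syt_Suc:
  assumes \<kappa>: "antimono \<kappa>" and supp: "\<forall>i\<ge>N. \<kappa> i = 0" and j: "j \<le> r"
  shows "card (initial_syt j \<kappa> (Suc r)) = card (initial_syt j \<kappa> r)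
    + (\<Sum>i | i < N \<and> 0 < \<kappa> i \<and> antimono (\<kappa>(i := \<kappa> i - 1)). card (initial_syt j (\<kappa>(i := \<kappa> i - 1)) r))"
proof -
  let ?I = "{i. i < N \<and> 0 < \<kappa> i \<and> antimono (\<kappa>(i := \<kappa> i - 1))}"
  let ?B = "\<lambda>i. {T \<in> initial_syt j \<kappa> (Suc r). T (i, \<kappa> i - 1) = Suc r}"
  have fin: "finite (initial_syt j \<kappa> n)" for n
    unfolding initial_syt_def by (simp add: finite_syt finite_shape[OF supp])
  have "T \<in> initial_syt j \<kappa> r \<union> (\<Union>i\<in>?I. ?B i)" if T: "T \<in> initial_syt j \<kappa> (Suc r)" for T
  proof (cases "Suc r \<in> T ` shape \<kappa>")
    case True
    then obtain i c where c: "c < \<kappa> i" "T (i, c) = Suc r" by auto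
    have "T \<in> syt \<kappa> (Suc r)" using T by (simp add: initial_syt_def)
    note d = sytD[OF this]
    \<comment> \<open>No entry exceeds \<open>Suc r\<close>, so its box has no neighbour to the
      right and, by the next step, none below: it is a corner.\<close>
    have "c = \<kappa> i - 1"
    proof (rule ccontr)
      assume "c \<noteq> \<kappa> i - 1"
      then have "Suc c < \<kappa> i" using c(1) by simp
      with d(5)[of c "Suc c" i] d(4)[of "Suc c" i] c show False by simp
    qed
    have "\<kappa> (Suc i) \<le> c"
    proof (rule ccontr)
      assume "\<not> \<kappa> (Suc i) \<le> c"
      with d(6)[of i "Suc i" c] d(4)[of c "Suc i"] c show False by simp
    qed
    have "(\<kappa>(i := \<kappa> i - 1)) (Suc m) \<le> (\<kappa>(i := \<kappa> i - 1)) m" for m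
      using antimonoD[OF \<kappa>, of m "Suc m"] \<open>\<kappa> (Suc i) \<le> c\<close> \<open>c = \<kappa> i - 1\<close>
      by (cases "m = i"; cases "Suc m = i") simp_all
    then have "antimono (\<kappa>(i := \<kappa> i - 1))" unfolding antimono_iff_le_Suc by blast
    moreover have "i < N" using c(1) supp by (metis not_less not_less0)
    ultimately have "i \<in> ?I" using c(1) by simp
    moreover have "T \<in> ?B i" using c(2) T unfolding \<open>c = \<kappa> i - 1\<close> by blast
    ultimately show ?thesis by blast
  next
    case False
    have T': "T \<in> syt \<kappa> (Suc r)" "{1..j} \<subseteq> column_0 \<kappa> T"
      using T unfolding initial_syt_def by blast+
    note d = sytD(1)[OF T'(1)]
    have "T \<in> shape \<kappa> \<rightarrow>\<^sub>E {1..r}"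
    proof (rule PiE_I)
      fix b assume b: "b \<in> shape \<kappa>"
      then have "T b \<noteq> Suc r" using False by (metis imageI)
      with PiE_mem[OF d b] show "T b \<in> {1..r}" by auto
    qed (rule PiE_arb[OF d])
    then have "T \<in> syt \<kappa> r" using T' unfolding syt_def by blast
    then show ?thesis using T'(2) by (simp add: initial_syt_def)
  qed
  moreover have "T \<in> initial_syt j \<kappa> (Suc r)" if T: "T \<in> initial_syt j \<kappa> r" for T
  proof -
    have "shape \<kappa> \<rightarrow>\<^sub>E {1..r} \<subseteq> shape \<kappa> \<rightarrow>\<^sub>E {1..Suc r}" by (rule PiE_mono) simp
    then have "T \<in> shape \<kappa> \<rightarrow>\<^sub>E {1..Suc r}" using T sytD(1) unfolding initial_syt_def by blast
    then show ?thesis using T unfolding initial_syt_def syt_def by blast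
  qed
  ultimately have eq: "initial_syt j \<kappa> (Suc r) = initial_syt j \<kappa> r \<union> (\<Union>i\<in>?I. ?B i)" by blast
  have "T (i, \<kappa> i - 1) \<noteq> Suc r" if "T \<in> initial_syt j \<kappa> r" "i \<in> ?I" for T i
    using sytD(4)[of T \<kappa> r "\<kappa> i - 1" i] that by (simp add: initial_syt_def)
  then have disj: "initial_syt j \<kappa> r \<inter> (\<Union>i\<in>?I. ?B i) = {}" by blast
  have "?B i \<inter> ?B i' = {}" if "i \<in> ?I" "i' \<in> ?I" "i \<noteq> i'" for i i'
  proof -
    have False if T: "T \<in> ?B i" "T \<in> ?B i'" for T
    proof -
      have "inj_on T (shape \<kappa>)" using T(1) sytD(2) unfolding initial_syt_def by blast
      from inj_onD[OF this, of "(i, \<kappa> i - 1)" "(i', \<kappa> i' - 1)"] show False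
        using T \<open>i \<in> ?I\<close> \<open>i' \<in> ?I\<close> \<open>i \<noteq> i'\<close> by simp
    qed
    then show ?thesis by blast
  qed
  moreover have finB: "finite (?B i)" for i using fin by simp
  ultimately have "card (\<Union>i\<in>?I. ?B i) = (\<Sum>i\<in>?I. card (?B i))"
    by (intro card_UN_disjoint) (simp, blast+)
  also have "\<dots> = (\<Sum>i\<in>?I. card (initial_syt j (\<kappa>(i := \<kappa> i - 1)) r))"
    using card_initial_syt_max_at j by (intro sum.cong refl) blast
  finally have "card (\<Union>i\<in>?I. ?B i) = (\<Sum>i\<in>?I. card (initial_syt j (\<kappa>(i := \<kappa> i - 1)) r))" .
  moreover have "card (initial_syt j \<kappa> (Suc r)) = card (initial_syt j \<kappa> r) + card (\<Union>i\<in>?I. ?B i)"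
    by (subst eq, rule card_Un_disjoint[OF fin _ disj], intro finite_UN_I finB) simp
  ultimately show ?thesis by simp
qed

text \<open>The first column already contains all available entries \<open>1, ..., j\<close>; a box
  in another column would repeat one of them.\<close>

lemma initial_syt_self_shape:
  assumes \<kappa>: "\<kappa> \<in> partition_funs N k" and T: "T \<in> initial_syt j \<kappa> j"
  shows "\<kappa> = one_column j" and "k = j"
proof -
  note p = partition_funsD[OF \<kappa>]
  have T': "T \<in> syt \<kappa> j" "{1..j} \<subseteq> column_0 \<kappa> T" using T by (auto simp: initial_syt_def)
  note d = sytD[OF T'(1)]
  have le: "\<kappa> a \<le> 1" for a
  proof (rule ccontr)
    assume "\<not> \<kappa> a \<le> 1"
    then have a: "1 < \<kappa> a" by simp
    then have "T (a, 1) \<in> {1..j}" using PiE_mem[OF d(1), of "(a, 1)"] by simp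
    with T'(2) obtain a' where "T (a, 1) = T (a', 0)" "0 < \<kappa> a'" by (auto simp: column_0_def)
    with inj_onD[OF d(2), of "(a, 1)" "(a', 0)"] a show False by simp
  qed
  have "T ` shape \<kappa> = {1..j}"
    using T'(2) column_0_subset[of \<kappa> T] PiE_mem[OF d(1)] by blast
  then have "card (shape \<kappa>) = j" using card_image[OF d(2)] by simp
  then show "k = j" using card_shape[OF p(2)] p(3) by simp
  define c where "c = (LEAST c. \<kappa> c = 0)"
  have "\<kappa> c = 0" unfolding c_def by (rule LeastI[of _ N]) (use p(2) in simp)
  then have zero: "\<kappa> i = 0" if "c \<le> i" for i using antimonoD[OF p(1) that] by simp
  have pos: "\<kappa> i > 0" if "i < c" for i using not_less_Least that unfolding c_def by blast
  have "\<kappa> i = one_column c i" for i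
    using zero[of i] le[of i] pos[of i] by (cases "i < c") (auto simp: one_column_def)
  then have eq: "\<kappa> = one_column c" by blast
  have "c \<le> N" unfolding c_def by (rule Least_le) (use p(2) in simp)
  then have "c = k" using p(3) eq by (simp add: sum_one_column)
  with eq \<open>k = j\<close> show "\<kappa> = one_column j" by simp
qed

text \<open>A strictly increasing column of length \<open>j\<close> with entries from
  \<open>1, ..., j\<close> is forced to be \<open>1, ..., j\<close>.\<close>

lemma card_initial_syt_one_column: "card (initial_syt j (one_column j) j) = 1"
proof -
  let ?T = "\<lambda>b. if b \<in> shape (one_column j) then Suc (fst b) else undefined"
  have sh: "(a, c) \<in> shape (one_column j) \<longleftrightarrow> a < j \<and> c = 0" for a c
    by (auto simp: one_column_def)
  have "T = ?T" if T: "T \<in> initial_syt j (one_column j) j" for T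
  proof
    fix b
    have "T \<in> syt (one_column j) j" using T by (simp add: initial_syt_def)
    note d = sytD[OF this]
    have lower: "a < j \<Longrightarrow> Suc a \<le> T (a, 0)" for a
    proof (induction a)
      case 0
      then show ?case using d(3)[of 0 0] by (simp add: one_column_def)
    next
      case (Suc a)
      then show ?case using d(6)[of a "Suc a" 0] by (simp add: one_column_def)
    qed
    \<comment> \<open>Here \<open>m\<close> counts rows upwards from the bottom; together with
      \<open>lower\<close> this pins down every entry.\<close>
    have upper: "m < j \<Longrightarrow> T (j - 1 - m, 0) + m \<le> j" for m
    proof (induction m)
      case 0
      then show ?case using d(4)[of 0 "j - 1"] by (simp add: one_column_def)
    next
      case (Suc m)
      then have "j - 1 - Suc m < j - 1 - m" by simp
      with Suc show ?case using d(6)[of "j - 1 - Suc m" "j - 1 - m" 0] by (simp add: one_column_def)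
    qed
    have "T (a, 0) = Suc a" if "a < j" for a
      using lower[OF that] upper[of "j - 1 - a"] that by simp
    then show "T b = ?T b" using sh PiE_arb[OF d(1), of b] by (cases b) (auto simp del: mem_shape)
  qed
  moreover have "?T \<in> initial_syt j (one_column j) j"
  proof -
    have "?T \<in> syt (one_column j) j" unfolding syt_def
      by (auto simp: one_column_def inj_on_def of_bool_def split: if_splits)
    moreover have "m \<in> column_0 (one_column j) ?T" if "m \<in> {1..j}" for m
      unfolding column_0_def using that by (intro CollectI exI[of _ "m - 1"]) (auto simp: one_column_def)
    ultimately show ?thesis by (auto simp: initial_syt_def)
  qed
  ultimately have "initial_syt j (one_column j) j = {?T}" by blast
  then show ?thesis by simp
qed

section \<open>Iterating the Pieri rule\<close>

text \<open>Removing boxes in the coefficients is adjoint to adding boxes in the Schur polynomials: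
  pairs of a shape and a removable box correspond to pairs of a smaller shape and an addable box.
  The Pieri rule then produces the power sum.\<close>

lemma sum_partition_funs_remove_box:
  fixes x :: "nat \<Rightarrow> 'a::comm_ring_1" and c :: "(nat \<Rightarrow> nat) \<Rightarrow> 'a"
  assumes "n \<le> N"
  shows "(\<Sum>\<kappa>\<in>partition_funs N (Suc k).
      (\<Sum>i | i < N \<and> 0 < \<kappa> i \<and> antimono (\<kappa>(i := \<kappa> i - 1)). c (\<kappa>(i := \<kappa> i - 1))) * branch_schur N x n \<kappa>)
    = (\<Sum>i=1..n. x i) * (\<Sum>\<kappa>\<in>partition_funs N k. c \<kappa> * branch_schur N x n \<kappa>)"
proof -
  let ?S = "branch_schur N x n"
  let ?I = "\<lambda>\<kappa> :: nat \<Rightarrow> nat. {i. i < N \<and> 0 < \<kappa> i \<and> antimono (\<kappa>(i := \<kappa> i - 1))}"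
  let ?J = "\<lambda>\<kappa> :: nat \<Rightarrow> nat. {i. i < N \<and> antimono (\<kappa>(i := Suc (\<kappa> i)))}"
  have "(\<Sum>\<kappa>\<in>partition_funs N (Suc k). (\<Sum>i\<in>?I \<kappa>. c (\<kappa>(i := \<kappa> i - 1))) * ?S \<kappa>)
      = (\<Sum>(\<kappa>, i)\<in>Sigma (partition_funs N (Suc k)) ?I. c (\<kappa>(i := \<kappa> i - 1)) * ?S \<kappa>)"
    unfolding sum_distrib_right by (rule sum.Sigma) (simp_all add: finite_partition_funs)
  also have "\<dots> = (\<Sum>(\<kappa>, i)\<in>Sigma (partition_funs N k) ?J. c \<kappa> * ?S (\<kappa>(i := Suc (\<kappa> i))))"
  proof (rule sum.reindex_bij_witness[where i = "\<lambda>(\<kappa>, i). (\<kappa>(i := Suc (\<kappa> i)), i)"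
        and j = "\<lambda>(\<kappa>, i). (\<kappa>(i := \<kappa> i - 1), i)"])
    fix p assume "p \<in> Sigma (partition_funs N (Suc k)) ?I"
    then obtain \<kappa> i where p: "p = (\<kappa>, i)" "\<kappa> \<in> partition_funs N (Suc k)" "i < N" "0 < \<kappa> i"
      "antimono (\<kappa>(i := \<kappa> i - 1))" by blast
    note d = partition_funsD[OF p(2)]
    have upd: "(\<kappa>(i := \<kappa> i - 1))(i := Suc ((\<kappa>(i := \<kappa> i - 1)) i)) = \<kappa>" using p(4) by simp
    show "(\<lambda>(\<kappa>, i). (\<kappa>(i := Suc (\<kappa> i)), i)) ((\<lambda>(\<kappa>, i). (\<kappa>(i := \<kappa> i - 1), i)) p) = p"
      unfolding p(1) prod.case upd ..
    have "Suc (sum (\<kappa>(i := \<kappa> i - 1)) {..<N}) = Suc k"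
      using sum_add_box[OF p(3), of "\<kappa>(i := \<kappa> i - 1)"] d(3) unfolding upd by simp
    moreover have "\<forall>a\<ge>N. (\<kappa>(i := \<kappa> i - 1)) a = 0" using d(2) p(3) by simp
    ultimately have "\<kappa>(i := \<kappa> i - 1) \<in> partition_funs N k"
      using p(5) unfolding partition_funs_def by blast
    moreover have "i \<in> ?J (\<kappa>(i := \<kappa> i - 1))" unfolding mem_Collect_eq upd using p(3) d(1) by blast
    ultimately show "(\<lambda>(\<kappa>, i). (\<kappa>(i := \<kappa> i - 1), i)) p \<in> Sigma (partition_funs N k) ?J"
      unfolding p(1) prod.case by blast
    show "(case (\<lambda>(\<kappa>, i). (\<kappa>(i := \<kappa> i - 1), i)) p of (\<kappa>, i) \<Rightarrow> c \<kappa> * ?S (\<kappa>(i := Suc (\<kappa> i))))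
        = (case p of (\<kappa>, i) \<Rightarrow> c (\<kappa>(i := \<kappa> i - 1)) * ?S \<kappa>)"
      unfolding p(1) prod.case upd ..
  next
    fix p assume "p \<in> Sigma (partition_funs N k) ?J"
    then obtain \<kappa> i where p: "p = (\<kappa>, i)" "\<kappa> \<in> partition_funs N k" "i < N"
      "antimono (\<kappa>(i := Suc (\<kappa> i)))" by blast
    note d = partition_funsD[OF p(2)]
    have upd: "(\<kappa>(i := Suc (\<kappa> i)))(i := (\<kappa>(i := Suc (\<kappa> i))) i - 1) = \<kappa>" by simp
    show "(\<lambda>(\<kappa>, i). (\<kappa>(i := \<kappa> i - 1), i)) ((\<lambda>(\<kappa>, i). (\<kappa>(i := Suc (\<kappa> i)), i)) p) = p"
      unfolding p(1) prod.case upd ..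
    have "\<forall>a\<ge>N. (\<kappa>(i := Suc (\<kappa> i))) a = 0" using d(2) p(3) by simp
    moreover have "sum (\<kappa>(i := Suc (\<kappa> i))) {..<N} = Suc k" using sum_add_box[OF p(3)] d(3) by simp
    ultimately have "\<kappa>(i := Suc (\<kappa> i)) \<in> partition_funs N (Suc k)"
      using p(4) unfolding partition_funs_def by blast
    moreover have "0 < (\<kappa>(i := Suc (\<kappa> i))) i" by simp
    then have "i \<in> ?I (\<kappa>(i := Suc (\<kappa> i)))" unfolding mem_Collect_eq upd using p(3) d(1) by blast
    ultimately show "(\<lambda>(\<kappa>, i). (\<kappa>(i := Suc (\<kappa> i)), i)) p \<in> Sigma (partition_funs N (Suc k)) ?I"
      unfolding p(1) prod.case by blast
  qed
  also have "\<dots> = (\<Sum>\<kappa>\<in>partition_funs N k. \<Sum>i\<in>?J \<kappa>. c \<kappa> * ?S (\<kappa>(i := Suc (\<kappa> i))))"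
    by (rule sum.Sigma[symmetric]) (simp_all add: finite_partition_funs)
  also have "\<dots> = (\<Sum>\<kappa>\<in>partition_funs N k. c \<kappa> * ((\<Sum>i=1..n. x i) * ?S \<kappa>))"
  proof (rule sum.cong[OF refl])
    fix \<kappa> assume "\<kappa> \<in> partition_funs N k"
    note d = partition_funsD[OF this]
    \<comment> \<open>The rows missing from \<open>?J \<kappa>\<close> lead to shapes that are not
      partitions, whose terms vanish.\<close>
    have "(\<Sum>i\<in>?J \<kappa>. ?S (\<kappa>(i := Suc (\<kappa> i)))) = (\<Sum>i<N. ?S (\<kappa>(i := Suc (\<kappa> i))))"
      by (rule sum.mono_neutral_left)
        (auto simp: branch_schur_not_antimono simp del: branch_schur.simps)
    also have "\<dots> = (\<Sum>i=1..n. x i) * ?S \<kappa>" using branch_schur_pieri[OF d(1,2) assms] ..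
    finally show "(\<Sum>i\<in>?J \<kappa>. c \<kappa> * ?S (\<kappa>(i := Suc (\<kappa> i)))) = c \<kappa> * ((\<Sum>i=1..n. x i) * ?S \<kappa>)"
      unfolding sum_distrib_left[symmetric] by simp
  qed
  finally show ?thesis by (simp add: sum_distrib_left mult.left_commute)
qed

text \<open>Induction on the largest admissible entry \<open>r\<close>, for all \<open>m\<close> at
  once. Fillings without \<open>Suc r\<close> give \<open>(r - j) choose m\<close>; removing
  \<open>Suc r\<close> from the others lowers \<open>m\<close> by one and gives a factor
  \<open>\<Sum>i=1..n. x i\<close>. Pascal's rule adds the two.\<close>

lemma sum_card_initial_syt:
  fixes x :: "nat \<Rightarrow> 'a::comm_ring_1"
  assumes "n \<le> N" and "j \<le> N" and "j \<le> r"
  shows "(\<Sum>\<kappa>\<in>partition_funs N (j + m). of_nat (card (initial_syt j \<kappa> r)) * branch_schur N x n \<kappa>)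
    = of_nat ((r - j) choose m) * (\<Sum>i=1..n. x i) ^ m * branch_schur N x n (one_column j)"
  using assms(3)
proof (induction r arbitrary: m rule: dec_induct)
  case base
  show ?case
  proof (cases m)
    case 0
    have "(\<Sum>\<kappa>\<in>partition_funs N j. of_nat (card (initial_syt j \<kappa> j)) * branch_schur N x n \<kappa>)
        = (\<Sum>\<kappa>\<in>{one_column j}. of_nat (card (initial_syt j \<kappa> j)) * branch_schur N x n \<kappa>)"
    proof (rule sum.mono_neutral_right)
      have "initial_syt j \<kappa> j = {}" if "\<kappa> \<in> partition_funs N j" "\<kappa> \<noteq> one_column j" for \<kappa>
        using initial_syt_self_shape(1)[OF that(1)] that(2) by blast
      then show "\<forall>\<kappa>\<in>partition_funs N j - {one_column j}. of_nat (card (initial_syt j \<kappa> j)) * branch_schur N x n \<kappa> = 0"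
        by simp
    qed (use one_column_partition_funs[OF assms(2)] finite_partition_funs in auto)
    then show ?thesis using 0 by (simp add: card_initial_syt_one_column)
  next
    case (Suc m')
    have "initial_syt j \<kappa> j = {}" if "\<kappa> \<in> partition_funs N (j + m)" for \<kappa>
      using initial_syt_self_shape(2)[OF that, of _ j] Suc by fastforce
    then show ?thesis using Suc by simp
  qed
next
  case (step r)
  let ?S = "branch_schur N x n" and ?p = "\<Sum>i=1..n. x i"
  let ?rec = "\<lambda>\<kappa>. \<Sum>i | i < N \<and> 0 < \<kappa> i \<and> antimono (\<kappa>(i := \<kappa> i - 1)). card (initial_syt j (\<kappa>(i := \<kappa> i - 1)) r)"
  have "(\<Sum>\<kappa>\<in>partition_funs N (j + m). of_nat (card (initial_syt j \<kappa> (Suc r))) * ?S \<kappa>)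
      = (\<Sum>\<kappa>\<in>partition_funs N (j + m). of_nat (card (initial_syt j \<kappa> r)) * ?S \<kappa> + of_nat (?rec \<kappa>) * ?S \<kappa>)"
  proof (rule sum.cong[OF refl])
    fix \<kappa> assume "\<kappa> \<in> partition_funs N (j + m)"
    note d = partition_funsD[OF this]
    show "of_nat (card (initial_syt j \<kappa> (Suc r))) * ?S \<kappa>
        = of_nat (card (initial_syt j \<kappa> r)) * ?S \<kappa> + of_nat (?rec \<kappa>) * ?S \<kappa>"
      unfolding card_initial_syt_Suc[OF d(1,2) step.hyps(1)] of_nat_add distrib_right ..
  qed
  also have "\<dots> = of_nat ((r - j) choose m) * ?p ^ m * ?S (one_column j)
      + (\<Sum>\<kappa>\<in>partition_funs N (j + m). of_nat (?rec \<kappa>) * ?S \<kappa>)"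
    unfolding sum.distrib step.IH ..
  also have "(\<Sum>\<kappa>\<in>partition_funs N (j + m). of_nat (?rec \<kappa>) * ?S \<kappa>)
      = (case m of 0 \<Rightarrow> 0 | Suc m' \<Rightarrow> of_nat ((r - j) choose m') * ?p ^ m * ?S (one_column j))"
  proof (cases m)
    case 0
    \<comment> \<open>For \<open>m = 0\<close> a removed box leaves fewer than \<open>j\<close>
      boxes, too few for the prescribed entries.\<close>
    have "card (initial_syt j (\<kappa>(i := \<kappa> i - 1)) r) = 0"
      if \<kappa>: "\<kappa> \<in> partition_funs N j" and i: "i < N" "0 < \<kappa> i" "antimono (\<kappa>(i := \<kappa> i - 1))" for \<kappa> i
    proof -
      note d = partition_funsD[OF \<kappa>]
      let ?k = "sum (\<kappa>(i := \<kappa> i - 1)) {..<N}"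
      have upd: "(\<kappa>(i := \<kappa> i - 1))(i := Suc ((\<kappa>(i := \<kappa> i - 1)) i)) = \<kappa>" using i(2) by simp
      have "?k < j" using sum_add_box[OF i(1), of "\<kappa>(i := \<kappa> i - 1)"] d(3) unfolding upd by simp
      moreover have "\<forall>a\<ge>N. (\<kappa>(i := \<kappa> i - 1)) a = 0" using d(2) i(1) by simp
      then have "\<kappa>(i := \<kappa> i - 1) \<in> partition_funs N ?k" using i(3) unfolding partition_funs_def by blast
      ultimately have "initial_syt j (\<kappa>(i := \<kappa> i - 1)) r = {}" by (rule initial_syt_eq_empty[rotated])
      then show ?thesis by simp
    qed
    then have "?rec \<kappa> = 0" if "\<kappa> \<in> partition_funs N j" for \<kappa>
      using that by (intro sum.neutral) blast
    then show ?thesis using 0 by (simp del: sum_eq_0_iff)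
  next
    case (Suc m')
    have "(\<Sum>\<kappa>\<in>partition_funs N (Suc (j + m')). of_nat (?rec \<kappa>) * ?S \<kappa>)
        = ?p * (of_nat ((r - j) choose m') * ?p ^ m' * ?S (one_column j))"
      unfolding of_nat_sum sum_partition_funs_remove_box[OF assms(1), of "\<lambda>\<kappa>. of_nat (card (initial_syt j \<kappa> r))"] step.IH ..
    then show ?thesis using Suc by (simp add: mult_ac)
  qed
  also have "of_nat ((r - j) choose m) * ?p ^ m * ?S (one_column j) + \<dots>
      = of_nat ((Suc r - j) choose m) * ?p ^ m * ?S (one_column j)"
    using step.hyps(1) by (cases m) (simp_all add: Suc_diff_le algebra_simps)
  finally show ?case .
qed

section \<open>The smallest missing number as an alternating sum\<close>

lemma sum_alternating_lessThan: "(\<Sum>j<m. (- 1) ^ j) = (of_bool (odd m) :: 'a::comm_ring_1)"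
  by (induction m) auto

text \<open>The filling contributes for exactly the \<open>j\<close> below the smallest missing
  number \<open>m\<close>, and the signs over \<open>j < m\<close> add up to 1 or 0 according to the
  parity of \<open>m\<close>.\<close>

lemma sum_alternating_initial:
  assumes \<kappa>: "\<kappa> \<in> partition_funs N k" and T: "T \<in> syt \<kappa> n"
  shows "(\<Sum>j\<le>k. (- 1) ^ j * of_bool ({1..j} \<subseteq> column_0 \<kappa> T))
    = (of_bool (odd (LEAST m. m \<ge> 1 \<and> m \<notin> column_0 \<kappa> T)) :: 'a::comm_ring_1)"
proof -
  let ?C = "column_0 \<kappa> T"
  define m where "m = (LEAST m. m \<ge> 1 \<and> m \<notin> ?C)"
  \<comment> \<open>With \<open>k\<close> boxes, some number up to \<open>Suc k\<close> is missing.
    So the \<open>LEAST\<close> is attained and \<open>m \<le> Suc k\<close>, which makes the range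
    \<open>j \<le> k\<close> contain all \<open>j < m\<close>.\<close>
  have "T \<notin> initial_syt (Suc k) \<kappa> n" using initial_syt_eq_empty[OF \<kappa>, of "Suc k"] by simp
  then have "\<not> {1..Suc k} \<subseteq> ?C" using T by (simp add: initial_syt_def)
  then obtain a where a: "1 \<le> a" "a \<le> Suc k" "a \<notin> ?C" by (meson atLeastAtMost_iff subsetI)
  have m: "m \<ge> 1 \<and> m \<notin> ?C" unfolding m_def by (rule LeastI[of _ a]) (use a in simp)
  have "m \<le> a" unfolding m_def by (rule Least_le) (use a in simp)
  with a have "m \<le> Suc k" by simp
  have "{1..j} \<subseteq> ?C \<longleftrightarrow> j < m" for j
  proof
    assume "{1..j} \<subseteq> ?C"
    with m show "j < m" by (meson atLeastAtMost_iff not_less subsetD)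
  next
    assume "j < m"
    then have "i \<in> ?C" if "1 \<le> i" "i \<le> j" for i
      using not_less_Least[of i "\<lambda>m. m \<ge> 1 \<and> m \<notin> ?C"] that unfolding m_def by simp
    then show "{1..j} \<subseteq> ?C" by auto
  qed
  then have "(\<Sum>j\<le>k. (- 1) ^ j * of_bool ({1..j} \<subseteq> ?C)) = (\<Sum>j\<le>k. (- 1) ^ j * of_bool (j < m) :: 'a)"
    by simp
  also have "\<dots> = (\<Sum>j<m. (- 1) ^ j)"
    using \<open>m \<le> Suc k\<close> by (intro sum.mono_neutral_cong_right) auto
  finally show ?thesis unfolding sum_alternating_lessThan m_def .
qed

text \<open>Exchanging the two sums collects, for each filling, the signs of all \<open>j\<close>
  for which it is counted.\<close>

lemma card_P_eq_sum_card_initial_syt: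
  assumes "row_lengths \<mu> \<in> partition_funs N k"
  shows "of_nat (card (P \<mu> n))
    = (\<Sum>j\<le>k. (- 1) ^ j * (of_nat (card (initial_syt j (row_lengths \<mu>) n)) :: 'a::comm_ring_1))"
proof -
  let ?\<kappa> = "row_lengths \<mu>"
  have fin: "finite (syt ?\<kappa> n)" by (rule finite_syt finite_shape partition_funsD(2) assms)+
  have card: "of_nat (card {T \<in> syt ?\<kappa> n. Q T}) = (\<Sum>T\<in>syt ?\<kappa> n. of_bool (Q T) :: 'a)" for Q
    using fin by (simp add: Collect_conj_eq)
  have col: "first_column \<mu> T = column_0 ?\<kappa> T" for T
    by (simp add: first_column_def column_0_def diagram_eq_shape)
  have "(\<Sum>j\<le>k. (- 1) ^ j * (of_nat (card (initial_syt j ?\<kappa> n)) :: 'a))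
      = (\<Sum>T\<in>syt ?\<kappa> n. \<Sum>j\<le>k. (- 1) ^ j * of_bool ({1..j} \<subseteq> column_0 ?\<kappa> T))"
    unfolding initial_syt_def card sum_distrib_left by (rule sum.swap)
  also have "\<dots> = (\<Sum>T\<in>syt ?\<kappa> n. of_bool (odd (LEAST m. m \<ge> 1 \<and> m \<notin> column_0 ?\<kappa> T)))"
    by (rule sum.cong[OF refl]) (rule sum_alternating_initial[OF assms])
  also have "\<dots> = of_nat (card (P \<mu> n))"
    unfolding P_def SYT_eq_syt col card ..
  finally show ?thesis ..
qed

theorem theorem3p3:
  fixes n k :: nat and x :: "nat \<Rightarrow> 'a::comm_ring_1"
  assumes "n \<ge> k" and "k \<ge> 1"
  shows "schur_bar (replicate k 1) n x
       = (\<Sum>\<mu>\<in>partitions_of k. of_nat (card (P \<mu> n)) * schur \<mu> n x)"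
proof -
  \<comment> \<open>The row bound is taken to be \<open>n\<close> itself, which suffices for
    partitions of \<open>k\<close> because \<open>k \<le> n\<close>.\<close>
  let ?S = "branch_schur n x n" and ?p = "\<Sum>j=1..n. x j"
  let ?A = "\<lambda>j \<kappa>. of_nat (card (initial_syt j \<kappa> n)) :: 'a"
  note bij = bij_betw_row_lengths[OF assms(1)]
  have "(\<Sum>\<mu>\<in>partitions_of k. of_nat (card (P \<mu> n)) * schur \<mu> n x)
      = (\<Sum>\<mu>\<in>partitions_of k. (\<Sum>j\<le>k. (- 1) ^ j * ?A j (row_lengths \<mu>)) * ?S (row_lengths \<mu>))"
  proof (rule sum.cong[OF refl])
    fix \<mu> assume "\<mu> \<in> partitions_of k"
    then have "row_lengths \<mu> \<in> partition_funs n k" using bij by (blast dest: bij_betwE)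
    then show "of_nat (card (P \<mu> n)) * schur \<mu> n x
        = (\<Sum>j\<le>k. (- 1) ^ j * ?A j (row_lengths \<mu>)) * ?S (row_lengths \<mu>)"
      by (simp only: card_P_eq_sum_card_initial_syt schur_eq_branch_schur)
  qed
  also have "\<dots> = (\<Sum>\<kappa>\<in>partition_funs n k. (\<Sum>j\<le>k. (- 1) ^ j * ?A j \<kappa>) * ?S \<kappa>)"
    by (rule sum.reindex_bij_betw[OF bij])
  also have "\<dots> = (\<Sum>j\<le>k. (- 1) ^ j * (\<Sum>\<kappa>\<in>partition_funs n k. ?A j \<kappa> * ?S \<kappa>))"
    unfolding sum_distrib_right sum_distrib_left mult.assoc by (rule sum.swap)
  also have "\<dots> = (\<Sum>j\<le>k. (- 1) ^ j * of_nat ((n - j) choose (k - j)) * ?p ^ (k - j) * ?S (one_column j))"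
  proof (rule sum.cong[OF refl])
    fix j assume "j \<in> {..k}"
    then show "(- 1) ^ j * (\<Sum>\<kappa>\<in>partition_funs n k. ?A j \<kappa> * ?S \<kappa>)
        = (- 1) ^ j * of_nat ((n - j) choose (k - j)) * ?p ^ (k - j) * ?S (one_column j)"
      \<comment> \<open>With \<open>m = k - j\<close> the shapes have \<open>j + (k - j) = k\<close>
        boxes, as \<open>j \<le> k\<close>.\<close>
      using sum_card_initial_syt[where n = n and N = n and j = j and r = n and m = "k - j" and x = x] assms(1) by (simp add: mult.assoc)
  qed
  \<comment> \<open>The expansion for arbitrary \<open>y\<close> is read backwards with
    \<open>y\<close> equal to the sum of all \<open>n\<close> variables.\<close>
  also have "\<dots> = branch_schur n (\<lambda>i. ?p - x i) n (one_column k)"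
    by (rule branch_schur_one_column_diff[OF assms(1), symmetric])
  also have "\<dots> = schur_bar (replicate k 1) n x"
    unfolding schur_bar_def row_lengths_replicate_1[symmetric]
    by (rule schur_eq_branch_schur[where k = k, symmetric])
      (simp only: row_lengths_replicate_1 one_column_partition_funs[OF assms(1)])
  finally show ?thesis ..
qed

end
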